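(* Let $n\ge 2$ and $m\ge 2$ be integers with $m\ge\sqrt{n}$, and let $B_1,\ldots,B_m$ be mutually unbiased orthonormal bases of $\mathbb{C}^n$. Let $\mathfrak{B}=\bigsqcup_{i=1}^m B_i$ (a set of $mn$ unit vectors). Choose $p$ vectors $s(1),\ldots,s(p)$ uniformly and independently from $\mathfrak{B}$, and let $\Phi_n$ be the $p\times n$ random matrix whose $i$-th row is $s(i)$. Let $\mathcal{G}_n=\Phi_n\Phi_n^*$ (where $\Phi_n^*$ is the conjugate transpose), and let $F_{\mathcal{G}_n}$ be its empirical spectral distribution. Then, for every $x\in\mathbb{R}$, as $n\to\infty$ with $p=p(n)$ and $m=m(n)\ge \sqrt n$ chosen so that $y=\frac{p}{n}\in(0,1)$ is fixed, we have $$F_{\mathcal{G}_n}(x)\to F_{\mathrm{MP},y}(x)\quad\text{in probability},$$ where $F_{\mathrm{MP},y}$ is the cumulative distribution function of the Marchenko–Pastur law with density $$f_{\mathrm{MP},y}(x)=\frac{1}{2\pi xy}\sqrt{(b-x)(x-a)}\,\mathbbm{1}_{[a,b]}(x),\qquad a=(1-\sqrt{y})^2,\quad b=(1+\sqrt{y})^2 .$$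
   Context: Orthonormal bases $B_1,\ldots,B_m$ of $\mathbb{C}^n$ are called mutually unbiased if for all $i\ne j$ and all $u\in B_i$, $v\in B_j$ one has $|\langle u,v\rangle|=\frac{1}{\sqrt n}$, where $\langle\cdot,\cdot\rangle$ is the standard Hermitian inner product on $\mathbb{C}^n$. For a $p\times p$ Hermitian matrix $\mathbf{A}$ with eigenvalues $\lambda_1,\ldots,\lambda_p$, its empirical spectral distribution is $F_{\mathbf{A}}(x)=\frac1p\#\{i:\lambda_i\le x\}$. The entries of $\mathcal{G}_n$ are $(\mathcal{G}_n)_{ij}=\langle s(i),s(j)\rangle$. $\mathbbm{1}_{[a,b]}$ denotes the indicator function of $[a,b]$. *)

theory Defs
  imports "HOL-Probability.Probability" "Jordan_Normal_Form.Schur_Decomposition"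
    "Jordan_Normal_Form.Char_Poly"
begin

definition herm_inner :: "complex Matrix.vec \<Rightarrow> complex Matrix.vec \<Rightarrow> complex" where
  "herm_inner u v = (\<Sum>k<dim_vec u. u $ k * cnj (v $ k))"

definition orthonormal_basis :: "nat \<Rightarrow> (nat \<Rightarrow> complex Matrix.vec) \<Rightarrow> bool" where
  "orthonormal_basis n b \<longleftrightarrow>
     (\<forall>j<n. b j \<in> carrier_vec n) \<and>
     (\<forall>j<n. \<forall>j'<n. herm_inner (b j) (b j') = (if j = j' then 1 else 0))"

definition mutually_unbiased :: "nat \<Rightarrow> nat \<Rightarrow> (nat \<Rightarrow> nat \<Rightarrow> complex Matrix.vec) \<Rightarrow> bool" where
  "mutually_unbiased n m B \<longleftrightarrow>
     (\<forall>i<m. orthonormal_basis n (B i)) \<and>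
     (\<forall>i<m. \<forall>i'<m. i \<noteq> i' \<longrightarrow> (\<forall>j<n. \<forall>j'<n.
        cmod (herm_inner (B i j) (B i' j')) = 1 / sqrt (real n)))"

definition esd :: "complex mat \<Rightarrow> real \<Rightarrow> real" where
  "esd A x = (1 / real (dim_row A)) *
     real (\<Sum>z \<in> {z. poly (char_poly A) z = 0 \<and> Im z = 0 \<and> Re z \<le> x}. Polynomial.order z (char_poly A))"

(* sample space: choices s : {0..<p} -> disjoint union of the bases, indexed by (basis, element) *)
definition sample_space :: "nat \<Rightarrow> nat \<Rightarrow> nat \<Rightarrow> (nat \<Rightarrow> nat \<times> nat) set" where
  "sample_space p m n = PiE {..<p} (\<lambda>_. {..<m} \<times> {..<n})"

definition Phi_mat :: "nat \<Rightarrow> nat \<Rightarrow> (nat \<Rightarrow> nat \<Rightarrow> complex Matrix.vec) \<Rightarrow> (nat \<Rightarrow> nat \<times> nat) \<Rightarrow> complex mat" where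
  "Phi_mat p n B s = mat p n (\<lambda>(i, k). B (fst (s i)) (snd (s i)) $ k)"

definition gram_mat :: "nat \<Rightarrow> nat \<Rightarrow> (nat \<Rightarrow> nat \<Rightarrow> complex Matrix.vec) \<Rightarrow> (nat \<Rightarrow> nat \<times> nat) \<Rightarrow> complex mat" where
  "gram_mat p n B s = Phi_mat p n B s * mat_adjoint (Phi_mat p n B s)"

definition mp_density :: "real \<Rightarrow> real \<Rightarrow> real" where
  "mp_density y x = (let a = (1 - sqrt y)^2; b = (1 + sqrt y)^2 in
     (if a \<le> x \<and> x \<le> b then sqrt ((b - x) * (x - a)) / (2 * pi * x * y) else 0))"

definition mp_cdf :: "real \<Rightarrow> real \<Rightarrow> real" where
  "mp_cdf y x = (\<integral>t. indicator {..x} t * mp_density y t \<partial>lborel)"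

end

theory Submission
  imports Defs "HOL-Real_Asymp.Real_Asymp"
begin

text \<open>
  Stieltjes transforms at negative reals. Let \<open>R = (t + \<Phi>\<^sup>*\<Phi>)\<^sup>-\<^sup>1\<close> with \<open>t > 0\<close>,
  let \<open>g = tr R / n\<close>, and let \<open>q\<^sub>i\<close> be the quadratic form of \<open>s(i)\<close> in the resolvent with the
  \<open>i\<close>-th row left out. The rank-one update formula gives \<open>t g + (1/n) \<Sum>\<^sub>i q\<^sub>i / (1 + q\<^sub>i) = 1\<close>.
  The matrices \<open>b b\<^sup>* - I/n\<close> for \<open>b\<close> in different unbiased bases are orthogonal, so Bessel's
  inequality bounds the variance over \<open>b\<close> of a quadratic form \<open>b\<^sup>* A b\<close> by \<open>|A|\<^sup>2 / (m n)\<close>;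
  this makes \<open>q\<^sub>i\<close> close to \<open>g\<close> in mean, with error \<open>O(m\<^sup>-\<^sup>1\<^sup>/\<^sup>2 + n\<^sup>-\<^sup>1)\<close>. Hence \<open>g\<close> is close to the
  root of \<open>t g + y g / (1 + g) = 1\<close>, which is explicit and agrees with the Stieltjes transform of
  the Marchenko-Pastur law. Test functions \<open>1 / (u + t)\<close> generate, by partial fractions and
  Weierstrass, all continuous functions of \<open>1 / (1 + u)\<close>, and these sandwich indicators.
\<close>

section \<open>Resolvents of frame operators\<close>

text \<open>At negative reals all quantities are real and nonnegative: the denominators 1 + q_i are
  at least 1 and u / (1 + u) is 1-Lipschitz, so errors simply add up. Leaving out row i makes the
  resolvent independent of s(i), and averaging over s(i) becomes a deterministic statement about a
  fixed matrix. Putting the row back moves the trace by at most 1/t, which is the n^-1 part of the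
  error. The map g -> t g + y g / (1 + g) has slope at least t, so an approximate root is near the
  true one. All estimates are averages of absolute deviations over the finite sample space; Markov's
  inequality turns them into probabilities at the end. The analysis takes place on the n-dimensional
  side, where a row is a rank-one term; the passage to the p x p Gram matrix costs only the explicit
  term (p - n) / t.\<close>

definition ip :: "'k set \<Rightarrow> ('k \<Rightarrow> complex) \<Rightarrow> ('k \<Rightarrow> complex) \<Rightarrow> complex" where
  "ip K u w = (\<Sum>k\<in>K. u k * cnj (w k))"

definition nrm2 :: "'k set \<Rightarrow> ('k \<Rightarrow> complex) \<Rightarrow> real" where
  "nrm2 K u = (\<Sum>k\<in>K. (cmod (u k))\<^sup>2)"

lemma nrm2_nonneg: "0 \<le> nrm2 K u"
  by (simp add: nrm2_def sum_nonneg)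

lemma ip_self: "ip K u u = of_real (nrm2 K u)"
  by (simp add: ip_def nrm2_def complex_norm_square del: of_real_power)

lemma ip_cong:
  "(\<And>k. k \<in> K \<Longrightarrow> u k = u' k) \<Longrightarrow> (\<And>k. k \<in> K \<Longrightarrow> w k = w' k) \<Longrightarrow> ip K u w = ip K u' w'"
  by (simp add: ip_def)

lemma ip_cnj: "cnj (ip K u w) = ip K w u"
  by (simp add: ip_def mult.commute)

lemma ip_scale_left: "ip K (\<lambda>k. c * u k) w = c * ip K u w"
  by (simp add: ip_def sum_distrib_left mult.assoc)

lemma ip_scale_right: "ip K u (\<lambda>k. c * w k) = cnj c * ip K u w"
  by (simp add: ip_def sum_distrib_left mult_ac)

lemma ip_diff_left: "ip K (\<lambda>k. u k - u' k) w = ip K u w - ip K u' w"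
  by (simp add: ip_def left_diff_distrib sum_subtractf)

lemma ip_diff_right: "ip K u (\<lambda>k. w k - w' k) = ip K u w - ip K u w'"
  by (simp add: ip_def right_diff_distrib sum_subtractf)

lemma ip_add_left: "ip K (\<lambda>k. u k + u' k) w = ip K u w + ip K u' w"
  by (simp add: ip_def distrib_right sum.distrib)

lemma ip_sum_left: "ip K (\<lambda>k. \<Sum>i\<in>I. u i k) w = (\<Sum>i\<in>I. ip K (u i) w)"
proof -
  have "ip K (\<lambda>k. \<Sum>i\<in>I. u i k) w = (\<Sum>k\<in>K. \<Sum>i\<in>I. u i k * cnj (w k))"
    by (simp add: ip_def sum_distrib_right)
  also have "\<dots> = (\<Sum>i\<in>I. ip K (u i) w)"
    unfolding ip_def by (rule sum.swap)
  finally show ?thesis .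
qed

lemma ip_sum_right: "ip K u (\<lambda>k. \<Sum>i\<in>I. w i k) = (\<Sum>i\<in>I. ip K u (w i))"
proof -
  have "ip K u (\<lambda>k. \<Sum>i\<in>I. w i k) = cnj (ip K (\<lambda>k. \<Sum>i\<in>I. w i k) u)"
    by (simp only: ip_cnj)
  also have "\<dots> = (\<Sum>i\<in>I. ip K u (w i))"
    by (simp only: ip_sum_left cnj_sum ip_cnj)
  finally show ?thesis .
qed

lemma nrm2_eq_0:
  assumes "finite K" "nrm2 K u = 0" "k \<in> K"
  shows "u k = 0"
  using assms by (auto simp: nrm2_def sum_nonneg_eq_0_iff)

text \<open>The matrix of this operator is t plus the sum of v_i v_i^*, the entrywise conjugate of t
  + Phi^* Phi when the v_i are the rows of Phi, so trace and spectrum agree. The index set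
  \<open>S\<close> is a parameter so that single rows can be removed and restored.\<close>

definition frame_op :: "nat \<Rightarrow> real \<Rightarrow> ('i \<Rightarrow> nat \<Rightarrow> complex) \<Rightarrow> 'i set \<Rightarrow> (nat \<Rightarrow> complex) \<Rightarrow> nat \<Rightarrow> complex" where
  "frame_op n t v S w = (\<lambda>k. of_real t * w k + (\<Sum>i\<in>S. ip {..<n} w (v i) * v i k))"

lemma ip_frame_op:
  "ip {..<n} (frame_op n t v S w) u
     = of_real t * ip {..<n} w u + (\<Sum>i\<in>S. ip {..<n} w (v i) * ip {..<n} (v i) u)"
  unfolding frame_op_def by (simp only: ip_add_left ip_scale_left ip_sum_left)

lemma ip_frame_op_commute:
  "ip {..<n} (frame_op n t v S w) u = ip {..<n} w (frame_op n t v S u)"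
proof -
  have "ip {..<n} w (frame_op n t v S u) = cnj (ip {..<n} (frame_op n t v S u) w)"
    by (simp only: ip_cnj)
  also have "\<dots> = ip {..<n} (frame_op n t v S w) u"
    by (simp only: ip_frame_op complex_cnj_add complex_cnj_mult cnj_sum ip_cnj complex_cnj_complex_of_real)
      (simp add: mult.commute)
  finally show ?thesis ..
qed

text \<open>For t > 0 both terms are nonnegative; injectivity and the bounds in 1/t on the resolvent
  come from this.\<close>

lemma ip_frame_op_self:
  "ip {..<n} (frame_op n t v S w) w
     = of_real (t * nrm2 {..<n} w + (\<Sum>i\<in>S. (cmod (ip {..<n} w (v i)))\<^sup>2))"
proof -
  have "ip {..<n} w (v i) * ip {..<n} (v i) w = of_real ((cmod (ip {..<n} w (v i)))\<^sup>2)" for i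
    by (simp only: complex_norm_square ip_cnj)
  then show ?thesis by (simp only: ip_frame_op ip_self of_real_add of_real_mult of_real_sum)
qed

lemma frame_op_diff:
  "frame_op n t v S (\<lambda>k. w k - w' k) k = frame_op n t v S w k - frame_op n t v S w' k"
  by (simp add: frame_op_def ip_diff_left left_diff_distrib sum_subtractf right_diff_distrib)

lemma frame_op_scale: "frame_op n t v S (\<lambda>k. c * w k) k = c * frame_op n t v S w k"
  by (simp add: frame_op_def ip_scale_left distrib_left sum_distrib_left mult_ac)

lemma frame_op_insert:
  assumes "finite S" "i \<notin> S"
  shows "frame_op n t v (insert i S) w k = frame_op n t v S w k + ip {..<n} w (v i) * v i k"
  using assms by (simp add: frame_op_def)

text \<open>The difference has vanishing quadratic form, hence vanishing norm. Resolvent identities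
  are proved below by applying \<open>frame_op\<close> to both sides and cancelling it with this
  lemma.\<close>

lemma frame_op_inj:
  assumes t: "0 < t" and eq: "\<And>k. k < n \<Longrightarrow> frame_op n t v S w k = frame_op n t v S w' k"
    and k: "k < n"
  shows "w k = w' k"
proof -
  let ?d = "\<lambda>k. w k - w' k"
  have "ip {..<n} (frame_op n t v S ?d) ?d = ip {..<n} (\<lambda>k. 0) ?d"
    by (rule ip_cong) (use eq in \<open>auto simp: frame_op_diff\<close>)
  also have "\<dots> = 0" by (simp add: ip_def)
  finally have "t * nrm2 {..<n} ?d + (\<Sum>i\<in>S. (cmod (ip {..<n} ?d (v i)))\<^sup>2) = 0"
    unfolding ip_frame_op_self of_real_eq_0_iff .
  moreover have "(\<Sum>i\<in>S. (cmod (ip {..<n} ?d (v i)))\<^sup>2) \<ge> 0" by (simp add: sum_nonneg)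
  ultimately have "t * nrm2 {..<n} ?d = 0"
    using t nrm2_nonneg[of "{..<n}" ?d] by (smt (verit) mult_nonneg_nonneg)
  then have "nrm2 {..<n} ?d = 0" using t by simp
  from nrm2_eq_0[OF _ this, of k] k show ?thesis by simp
qed

section \<open>Existence, symmetry and norm bounds of the resolvent\<close>

definition mat_app :: "nat \<Rightarrow> (nat \<Rightarrow> nat \<Rightarrow> complex) \<Rightarrow> (nat \<Rightarrow> complex) \<Rightarrow> nat \<Rightarrow> complex" where
  "mat_app n r x = (\<lambda>k. \<Sum>j<n. r k j * x j)"

text \<open>Injectivity makes the matrix of the operator nonsingular. Only the right-inverse
  property is recorded: together with \<open>frame_op_inj\<close> it determines the inverse.\<close>

lemma frame_op_inverse_exists:
  assumes t: "0 < t"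
  shows "\<exists>r. \<forall>x. \<forall>k<n. frame_op n t v S (mat_app n r x) k = x k"
proof -
  define a where "a = (\<lambda>k j. (if k = j then of_real t else 0) + (\<Sum>i\<in>S. v i k * cnj (v i j)))"
  define M where "M = mat n n (\<lambda>(k, j). a k j)"
  have a: "(\<Sum>j<n. a k j * w j) = frame_op n t v S w k" if "k < n" for k w
  proof -
    have "(\<Sum>j<n. (if k = j then of_real t else 0) * w j) = of_real t * w k"
      using that by (simp add: if_distrib[where f = "\<lambda>x. x * _"] sum.delta' cong: if_cong)
    moreover have "(\<Sum>j<n. (\<Sum>i\<in>S. v i k * cnj (v i j)) * w j) = (\<Sum>i\<in>S. ip {..<n} w (v i) * v i k)"
      by (simp add: ip_def sum_distrib_right sum_distrib_left mult_ac) (rule sum.swap)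
    ultimately show ?thesis by (simp add: a_def frame_op_def distrib_right sum.distrib)
  qed
  have M: "M \<in> carrier_mat n n" by (simp add: M_def)
  have "det M \<noteq> 0"
  proof
    assume "det M = 0"
    then obtain x where x: "x \<in> carrier_vec n" "x \<noteq> 0\<^sub>v n" "M *\<^sub>v x = 0\<^sub>v n"
      using det_0_iff_vec_prod_zero[OF M] by blast
    have "x $ k = 0" if "k < n" for k
    proof (rule frame_op_inj[where w' = "\<lambda>_. 0", OF t _ that])
      fix k assume k: "k < n"
      have "(M *\<^sub>v x) $ k = (\<Sum>j<n. a k j * x $ j)"
        using k x(1) by (auto simp: M_def scalar_prod_def atLeast0LessThan)
      then show "frame_op n t v S (($) x) k = frame_op n t v S (\<lambda>_. 0) k"
        using x(3) k a[OF k] by (simp add: frame_op_def ip_def)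
    qed
    then have "x = 0\<^sub>v n" using x(1) by (intro eq_vecI) auto
    with x(2) show False by simp
  qed
  from det_non_zero_imp_unit[OF M this, of undefined] obtain N where
    N: "N \<in> carrier_mat n n" and MN: "M * N = 1\<^sub>m n"
    by (auto simp: Units_def ring_mat_simps)
  have "frame_op n t v S (mat_app n (\<lambda>k j. N $$ (k, j)) x) k = x k" if k: "k < n" for x k
  proof -
    have e: "(\<Sum>l<n. a k l * N $$ (l, j)) = (if k = j then 1 else 0)" if "j < n" for j
    proof -
      have "(M * N) $$ (k, j) = (\<Sum>l<n. a k l * N $$ (l, j))"
        using k that N by (auto simp: M_def times_mat_def scalar_prod_def atLeast0LessThan)
      then show ?thesis using MN k that by simp
    qed
    have "frame_op n t v S (mat_app n (\<lambda>k j. N $$ (k, j)) x) k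
        = (\<Sum>l<n. \<Sum>j<n. a k l * (N $$ (l, j) * x j))"
      by (simp add: a[OF k, symmetric] mat_app_def sum_distrib_left)
    also have "\<dots> = (\<Sum>j<n. (\<Sum>l<n. a k l * N $$ (l, j)) * x j)"
      by (subst sum.swap) (simp add: sum_distrib_right mult.assoc)
    also have "\<dots> = (\<Sum>j<n. (if k = j then 1 else 0) * x j)"
      by (intro sum.cong) (auto simp: e)
    also have "\<dots> = x k"
      using k by (simp add: if_distrib[where f = "\<lambda>x. x * _"] sum.delta' cong: if_cong)
    finally show ?thesis .
  qed
  then show ?thesis by blast
qed

text \<open>For t > 0 the entries with indices below \<open>n\<close> are unique by
  \<open>frame_op_inj\<close>; the others are whatever \<open>SOME\<close> picks and do not affect
  \<open>rquad\<close> or \<open>rtrace\<close>.\<close>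

definition resolv :: "nat \<Rightarrow> real \<Rightarrow> ('i \<Rightarrow> nat \<Rightarrow> complex) \<Rightarrow> 'i set \<Rightarrow> nat \<Rightarrow> nat \<Rightarrow> complex" where
  "resolv n t v S = (SOME r. \<forall>x. \<forall>k<n. frame_op n t v S (mat_app n r x) k = x k)"

definition rtrace :: "nat \<Rightarrow> real \<Rightarrow> ('i \<Rightarrow> nat \<Rightarrow> complex) \<Rightarrow> 'i set \<Rightarrow> complex" where
  "rtrace n t v S = (\<Sum>k<n. resolv n t v S k k)"

lemma frame_op_resolv:
  assumes "0 < t" "k < n"
  shows "frame_op n t v S (mat_app n (resolv n t v S) x) k = x k"
  using someI_ex[OF frame_op_inverse_exists[OF assms(1), of n v S]] assms(2)
  unfolding resolv_def by blast

text \<open>\<open>SOME\<close> is applied to the same predicate on both sides. This is what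
  decouples a left-out row from the resolvent of the remaining ones.\<close>

lemma resolv_cong:
  assumes "\<And>i. i \<in> S \<Longrightarrow> v i = v' i"
  shows "resolv n t v S = resolv n t v' S"
proof -
  have "frame_op n t v S = frame_op n t v' S"
    using assms by (auto simp: frame_op_def intro!: ext sum.cong)
  then show ?thesis by (simp add: resolv_def)
qed

text \<open>The inverse inherits self-adjointness: write \<open>z\<close> as \<open>frame_op\<close>
  of its resolvent and move \<open>frame_op\<close> across.\<close>

lemma ip_resolv_commute:
  assumes t: "0 < t"
  shows "ip {..<n} (mat_app n (resolv n t v S) x) z = ip {..<n} x (mat_app n (resolv n t v S) z)"
proof -
  let ?R = "mat_app n (resolv n t v S)"
  have "ip {..<n} (?R x) z = ip {..<n} (?R x) (frame_op n t v S (?R z))"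
    by (rule ip_cong) (auto simp: frame_op_resolv[OF t])
  also have "\<dots> = ip {..<n} (frame_op n t v S (?R x)) (?R z)"
    by (simp only: ip_frame_op_commute)
  also have "\<dots> = ip {..<n} x (?R z)"
    by (rule ip_cong) (auto simp: frame_op_resolv[OF t])
  finally show ?thesis .
qed

definition rquad :: "nat \<Rightarrow> real \<Rightarrow> ('i \<Rightarrow> nat \<Rightarrow> complex) \<Rightarrow> 'i set \<Rightarrow> (nat \<Rightarrow> complex) \<Rightarrow> real" where
  "rquad n t v S x = Re (ip {..<n} x (mat_app n (resolv n t v S) x))"

text \<open>With w = R x and H the frame operator, <x, w> = <H w, w>, and
  \<open>ip_frame_op_self\<close> evaluates the right side.\<close>

lemma ip_resolv_self:
  assumes t: "0 < t"
  shows "ip {..<n} x (mat_app n (resolv n t v S) x) = of_real (rquad n t v S x)"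
    and "t * nrm2 {..<n} (mat_app n (resolv n t v S) x) \<le> rquad n t v S x"
proof -
  let ?w = "mat_app n (resolv n t v S) x"
  have "ip {..<n} x ?w = ip {..<n} (frame_op n t v S ?w) ?w"
    by (rule ip_cong) (auto simp: frame_op_resolv[OF t])
  also note ip_frame_op_self
  finally have e: "ip {..<n} x ?w
     = of_real (t * nrm2 {..<n} ?w + (\<Sum>i\<in>S. (cmod (ip {..<n} ?w (v i)))\<^sup>2))" .
  then show "ip {..<n} x ?w = of_real (rquad n t v S x)"
    by (simp only: rquad_def Re_complex_of_real)
  show "t * nrm2 {..<n} ?w \<le> rquad n t v S x"
    unfolding rquad_def e Re_complex_of_real by (simp add: sum_nonneg)
qed

lemma rquad_nonneg: "0 < t \<Longrightarrow> 0 \<le> rquad n t v S x"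
  using ip_resolv_self(2)[of t n v S x] nrm2_nonneg[of "{..<n}" "mat_app n (resolv n t v S) x"]
  by (smt (verit) mult_nonneg_nonneg)

definition stdb :: "nat \<Rightarrow> nat \<Rightarrow> complex" where
  "stdb j = (\<lambda>k. if k = j then 1 else 0)"

lemma mat_app_stdb: "j < n \<Longrightarrow> mat_app n r (stdb j) k = r k j"
  by (simp add: mat_app_def stdb_def if_distrib[where f = "\<lambda>x. _ * x"] cong: if_cong)

lemma ip_stdb:
  assumes "j < n"
  shows "ip {..<n} x (stdb j) = x j" "ip {..<n} (stdb j) x = cnj (x j)"
  using assms by (simp_all add: ip_def stdb_def if_distrib[where f = "\<lambda>x. _ * x"]
      if_distrib[where f = "\<lambda>x. x * _"] if_distrib[where f = cnj] cong: if_cong)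

lemma resolv_hermitian:
  assumes "0 < t" "j < n" "k < n"
  shows "resolv n t v S k j = cnj (resolv n t v S j k)"
  using ip_resolv_commute[OF assms(1), of n v S "stdb j" "stdb k"] assms(2,3)
  by (simp add: ip_stdb mat_app_stdb)

lemma rtrace_eq_rquad:
  assumes t: "0 < t"
  shows "rtrace n t v S = of_real (\<Sum>k<n. rquad n t v S (stdb k))"
proof -
  have "resolv n t v S k k = of_real (rquad n t v S (stdb k))" if "k < n" for k
    using ip_resolv_self(1)[OF t, of n "stdb k" v S] that ip_stdb[OF that] mat_app_stdb[OF that]
      resolv_hermitian[OF t that that, of v S] by simp
  then show ?thesis by (simp add: rtrace_def)
qed

text \<open>Each column w = R e_j satisfies t |w|^2 <= |w_j| <= |w|, so |w|^2 <= 1/t^2. The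
  Hilbert-Schmidt norm is the one that Bessel's inequality for quadratic forms consumes.\<close>

lemma nrm2_resolv_le:
  assumes t: "0 < t"
  shows "(\<Sum>j<n. nrm2 {..<n} (\<lambda>k. resolv n t v S k j)) \<le> real n / t\<^sup>2"
proof -
  have "nrm2 {..<n} (\<lambda>k. resolv n t v S k j) \<le> 1 / t\<^sup>2" if j: "j < n" for j
  proof -
    let ?w = "\<lambda>k. resolv n t v S k j"
    have w: "mat_app n (resolv n t v S) (stdb j) = ?w" using j by (auto simp: mat_app_stdb)
    have "t * nrm2 {..<n} ?w \<le> rquad n t v S (stdb j)"
      using ip_resolv_self(2)[OF t, of n v S "stdb j"] w by simp
    also have "\<dots> \<le> cmod (?w j)"
      unfolding rquad_def w ip_stdb[OF j] by (metis complex_Re_le_cmod complex_mod_cnj)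
    finally have 1: "t * nrm2 {..<n} ?w \<le> cmod (?w j)" .
    have "(cmod (?w j))\<^sup>2 \<le> nrm2 {..<n} ?w"
      unfolding nrm2_def by (rule member_le_sum[where f = "\<lambda>k. (cmod (?w k))\<^sup>2"]) (use j in auto)
    moreover have "(t * nrm2 {..<n} ?w)\<^sup>2 \<le> (cmod (?w j))\<^sup>2"
      using 1 t nrm2_nonneg[of "{..<n}" ?w] by (intro power_mono) auto
    ultimately have "t\<^sup>2 * nrm2 {..<n} ?w * nrm2 {..<n} ?w \<le> nrm2 {..<n} ?w"
      by (simp add: power2_eq_square mult_ac)
    then have "t\<^sup>2 * nrm2 {..<n} ?w \<le> 1"
      using nrm2_nonneg[of "{..<n}" ?w]
      by (cases "nrm2 {..<n} ?w = 0") (auto simp: mult_le_cancel_right)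
    then show ?thesis using t by (simp add: field_simps)
  qed
  then have "(\<Sum>j<n. nrm2 {..<n} (\<lambda>k. resolv n t v S k j)) \<le> (\<Sum>j<n. 1 / t\<^sup>2)"
    by (intro sum_mono) auto
  then show ?thesis by simp
qed

section \<open>Trace identity and rank-one updates\<close>

lemma rtrace_identity:
  assumes t: "0 < t"
  shows "of_real t * rtrace n t v S + (\<Sum>i\<in>S. of_real (rquad n t v S (v i))) = of_nat n"
proof -
  let ?r = "resolv n t v S"
  \<comment> \<open>The trace of the identity, written as the frame operator times its resolvent;
    the rank-one terms contribute the quadratic forms of the rows.\<close>
  have "of_nat n = (\<Sum>j<n. frame_op n t v S (mat_app n ?r (stdb j)) j)"
    by (simp add: frame_op_resolv[OF t]) (simp add: stdb_def)
  also have "\<dots> = of_real t * rtrace n t v S + (\<Sum>j<n. \<Sum>i\<in>S. ip {..<n} (mat_app n ?r (stdb j)) (v i) * v i j)"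
    by (simp add: frame_op_def sum.distrib rtrace_def sum_distrib_left mat_app_stdb)
  also have "(\<Sum>j<n. \<Sum>i\<in>S. ip {..<n} (mat_app n ?r (stdb j)) (v i) * v i j)
      = (\<Sum>j<n. \<Sum>i\<in>S. v i j * cnj (mat_app n ?r (v i) j))"
    by (intro sum.cong) (simp_all add: ip_resolv_commute[OF t] ip_stdb)
  also have "\<dots> = (\<Sum>i\<in>S. of_real (rquad n t v S (v i)))"
    by (subst sum.swap) (simp add: ip_resolv_self(1)[OF t, symmetric] ip_def)
  finally show ?thesis ..
qed

text \<open>The rank-one update on the updated vector, stated without division: the frame operator
  of the larger set sends both sides to (1 + q) v_i.\<close>

lemma resolv_insert_apply:
  assumes t: "0 < t" and S: "finite S" "i \<notin> S" and k: "k < n"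
  shows "mat_app n (resolv n t v (insert i S)) (v i) k * (1 + of_real (rquad n t v S (v i)))
       = mat_app n (resolv n t v S) (v i) k"
proof -
  let ?q = "of_real (rquad n t v S (v i)) :: complex"
  let ?R = "mat_app n (resolv n t v (insert i S))" and ?R' = "mat_app n (resolv n t v S)"
  have "(1 + ?q) * ?R (v i) k = ?R' (v i) k"
  proof (rule frame_op_inj[OF t _ k])
    fix l assume l: "l < n"
    have "frame_op n t v (insert i S) (\<lambda>k. (1 + ?q) * ?R (v i) k) l = (1 + ?q) * v i l"
      by (simp only: frame_op_scale frame_op_resolv[OF t l])
    also have "\<dots> = v i l + ip {..<n} (?R' (v i)) (v i) * v i l"
      by (simp add: ip_resolv_commute[OF t] ip_resolv_self(1)[OF t] algebra_simps)
    also have "\<dots> = frame_op n t v (insert i S) (?R' (v i)) l"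
      by (simp only: frame_op_insert[OF S] frame_op_resolv[OF t l])
    finally show "frame_op n t v (insert i S) (\<lambda>k. (1 + ?q) * ?R (v i) k) l
      = frame_op n t v (insert i S) (?R' (v i)) l" .
  qed
  then show ?thesis by (simp add: mult.commute)
qed

lemma rquad_insert:
  assumes t: "0 < t" and S: "finite S" "i \<notin> S"
  shows "rquad n t v (insert i S) (v i) = rquad n t v S (v i) / (1 + rquad n t v S (v i))"
proof -
  let ?q = "rquad n t v S (v i)"
  have "ip {..<n} (v i) (mat_app n (resolv n t v S) (v i))
      = ip {..<n} (v i) (\<lambda>k. of_real (1 + ?q) * mat_app n (resolv n t v (insert i S)) (v i) k)"
    using resolv_insert_apply[OF t S, of _ n v] by (intro ip_cong) (auto simp: mult.commute)
  also have "\<dots> = of_real (1 + ?q) * ip {..<n} (v i) (mat_app n (resolv n t v (insert i S)) (v i))"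
    by (simp only: ip_scale_right complex_cnj_complex_of_real)
  finally have "?q = (1 + ?q) * rquad n t v (insert i S) (v i)"
    unfolding ip_resolv_self(1)[OF t] of_real_mult[symmetric] of_real_eq_iff .
  then show ?thesis using rquad_nonneg[OF t, of n v S "v i"] by (simp add: field_simps)
qed

text \<open>Let R' belong to \<open>S\<close> and R to \<open>insert i S\<close>. Then R' - R is the
  rank-one matrix R v (R' v)^*, whose trace is |R' v|^2 / (1 + q) by
  \<open>resolv_insert_apply\<close>; since t |R' v|^2 <= q, it is at most 1/t.\<close>

lemma rtrace_insert:
  assumes t: "0 < t" and S: "finite S" "i \<notin> S"
  shows "cmod (rtrace n t v S - rtrace n t v (insert i S)) \<le> 1 / t"
proof -
  let ?q = "rquad n t v S (v i)"
  let ?R = "mat_app n (resolv n t v (insert i S))" and ?R' = "mat_app n (resolv n t v S)"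
  have q: "0 \<le> ?q" by (rule rquad_nonneg[OF t])
  have d: "resolv n t v S k j - resolv n t v (insert i S) k j = cnj (?R' (v i) j) * ?R (v i) k"
    if j: "j < n" and k: "k < n" for j k
  proof -
    have "?R' (stdb j) k - ?R (stdb j) k = cnj (?R' (v i) j) * ?R (v i) k"
    proof (rule frame_op_inj[OF t _ k])
      fix l assume l: "l < n"
      show "frame_op n t v (insert i S) (\<lambda>k. ?R' (stdb j) k - ?R (stdb j) k) l
        = frame_op n t v (insert i S) (\<lambda>k. cnj (?R' (v i) j) * ?R (v i) k) l"
        unfolding frame_op_diff frame_op_scale frame_op_resolv[OF t l]
        unfolding frame_op_insert[OF S] frame_op_resolv[OF t l] ip_resolv_commute[OF t] ip_stdb[OF j]
        by simp
    qed
    then show ?thesis by (simp add: mat_app_stdb j)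
  qed
  have "(1 + of_real ?q) * (rtrace n t v S - rtrace n t v (insert i S))
      = (\<Sum>k<n. cnj (?R' (v i) k) * (?R (v i) k * (1 + of_real ?q)))"
    by (simp add: rtrace_def sum_subtractf[symmetric] d sum_distrib_left mult_ac)
  also have "\<dots> = (\<Sum>k<n. cnj (?R' (v i) k) * ?R' (v i) k)"
    by (intro sum.cong) (simp_all add: resolv_insert_apply[OF t S])
  also have "\<dots> = of_real (nrm2 {..<n} (?R' (v i)))"
    by (simp only: ip_self[symmetric] ip_def mult.commute)
  finally have "cmod (1 + of_real ?q) * cmod (rtrace n t v S - rtrace n t v (insert i S))
     = nrm2 {..<n} (?R' (v i))"
    by (metis norm_mult norm_of_real abs_of_nonneg nrm2_nonneg)
  moreover have "cmod (1 + of_real ?q) = 1 + ?q"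
    using q by (metis norm_of_real abs_of_nonneg add_nonneg_nonneg of_real_1 of_real_add zero_le_one)
  ultimately have e: "(1 + ?q) * cmod (rtrace n t v S - rtrace n t v (insert i S)) = nrm2 {..<n} (?R' (v i))"
    by simp
  have "t * nrm2 {..<n} (?R' (v i)) \<le> 1 + ?q"
    using ip_resolv_self(2)[OF t, of n v S "v i"] by simp
  then have "(1 + ?q) * (t * cmod (rtrace n t v S - rtrace n t v (insert i S))) \<le> (1 + ?q) * 1"
    unfolding e[symmetric] by (simp add: mult_ac)
  then have "t * cmod (rtrace n t v S - rtrace n t v (insert i S)) \<le> 1"
    using q by (subst (asm) mult_le_cancel_left_pos) auto
  then show ?thesis using t by (simp add: field_simps)
qed

section \<open>Quadratic forms on mutually unbiased bases\<close>

text \<open>A one-sided inverse of a square matrix is two-sided, so orthonormal rows force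
  orthonormal columns.\<close>

lemma orthonormal_basis_complete:
  fixes b :: "nat \<Rightarrow> complex Matrix.vec"
  assumes "orthonormal_basis n b" and k: "k < n" and l: "l < n"
  shows "(\<Sum>j<n. b j $ k * cnj (b j $ l)) = (if k = l then 1 else 0)"
proof -
  have b: "b j \<in> carrier_vec n" if "j < n" for j
    using assms(1) that by (simp add: orthonormal_basis_def)
  have o: "(\<Sum>k<n. b j $ k * cnj (b j' $ k)) = (if j = j' then 1 else 0)" if "j < n" "j' < n" for j j'
  proof -
    have "herm_inner (b j) (b j') = (if j = j' then 1 else 0)"
      using assms(1) that by (simp add: orthonormal_basis_def)
    then show ?thesis using b[OF that(1)] by (simp add: herm_inner_def)
  qed
  define U where "U = mat n n (\<lambda>(j, k). b j $ k)"
  define V where "V = mat n n (\<lambda>(k, j). cnj (b j $ k))"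
  have UV: "U \<in> carrier_mat n n" "V \<in> carrier_mat n n" by (simp_all add: U_def V_def)
  have "U * V = 1\<^sub>m n"
    by (rule eq_matI) (auto simp: U_def V_def times_mat_def scalar_prod_def atLeast0LessThan o)
  from mat_mult_left_right_inverse[OF UV this] have "V * U = 1\<^sub>m n" .
  then have "(V * U) $$ (l, k) = (if k = l then 1 else 0)" using k l by simp
  moreover have "(V * U) $$ (l, k) = (\<Sum>j<n. b j $ k * cnj (b j $ l))"
    using k l by (simp add: U_def V_def times_mat_def scalar_prod_def atLeast0LessThan mult.commute)
  ultimately show ?thesis by simp
qed

text \<open>By completeness the matrices b_j b_j^* of one basis sum to the identity. The conjugate
  appears because \<open>ip\<close> conjugates its second argument.\<close>

lemma orthonormal_basis_trace:
  fixes b :: "nat \<Rightarrow> complex Matrix.vec"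
  assumes "orthonormal_basis n b"
  shows "(\<Sum>j<n. ip {..<n} (($) (b j)) (mat_app n r (($) (b j)))) = cnj (\<Sum>k<n. r k k)"
proof -
  have "(\<Sum>j<n. ip {..<n} (($) (b j)) (mat_app n r (($) (b j))))
      = (\<Sum>j<n. \<Sum>k<n. \<Sum>l<n. cnj (r k l) * (b j $ k * cnj (b j $ l)))"
    by (simp add: ip_def mat_app_def sum_distrib_left mult_ac)
  also have "\<dots> = (\<Sum>k<n. \<Sum>j<n. \<Sum>l<n. cnj (r k l) * (b j $ k * cnj (b j $ l)))"
    by (rule sum.swap)
  also have "\<dots> = (\<Sum>k<n. \<Sum>l<n. \<Sum>j<n. cnj (r k l) * (b j $ k * cnj (b j $ l)))"
    by (intro sum.cong refl sum.swap)
  also have "\<dots> = (\<Sum>k<n. \<Sum>l<n. cnj (r k l) * (if k = l then 1 else 0))"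
    by (intro sum.cong refl) (simp add: sum_distrib_left[symmetric] orthonormal_basis_complete[OF assms])
  also have "\<dots> = cnj (\<Sum>k<n. r k k)"
    by (simp add: if_distrib[where f = "\<lambda>x. _ * x"] cong: if_cong)
  finally show ?thesis .
qed

definition bvec :: "(nat \<Rightarrow> nat \<Rightarrow> complex Matrix.vec) \<Rightarrow> nat \<times> nat \<Rightarrow> nat \<Rightarrow> complex" where
  "bvec B x = ($) (B (fst x) (snd x))"

lemma mub_ip_bvec:
  assumes "mutually_unbiased n m B" and "x \<in> {..<m} \<times> {..<n}" "x' \<in> {..<m} \<times> {..<n}" and n: "0 < n"
  shows "(cmod (ip {..<n} (bvec B x) (bvec B x')))\<^sup>2
     = (if fst x = fst x' then (if snd x = snd x' then 1 else 0) else 1 / real n)"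
proof -
  have "B (fst x) (snd x) \<in> carrier_vec n"
    using assms(1,2) by (auto simp: mutually_unbiased_def orthonormal_basis_def)
  then have "ip {..<n} (bvec B x) (bvec B x') = herm_inner (B (fst x) (snd x)) (B (fst x') (snd x'))"
    by (simp add: ip_def bvec_def herm_inner_def)
  then show ?thesis
    using assms unfolding mutually_unbiased_def orthonormal_basis_def
    by (auto simp: power_divide)
qed

text \<open>In the Hilbert-Schmidt inner product \<open>P x\<close> and \<open>P x'\<close> pair to
  |<b, b'>|^2, and \<open>r\<close> pairs with \<open>P x\<close> to the quadratic form. The
  centring by I/n is carried by the coefficients: \<open>c\<close> sums to zero within each basis,
  and on such \<open>c\<close> the Gram kernel of the \<open>P x\<close> acts as the identity. Hence
  X, the sum of the c_x \<open>P x\<close>, has <A, X> = |X|^2 = sum of the c_x^2, and the claim is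
  |A - X|^2 >= 0.\<close>

lemma mub_bessel:
  assumes mub: "mutually_unbiased n m B" and n: "0 < n"
    and q: "\<And>x. x \<in> {..<m} \<times> {..<n} \<Longrightarrow> ip {..<n} (bvec B x) (mat_app n r (bvec B x)) = of_real (q x)"
    and tr: "(\<Sum>k<n. r k k) = of_real \<tau>"
  shows "(\<Sum>x\<in>{..<m} \<times> {..<n}. (q x - \<tau> / real n)\<^sup>2) \<le> (\<Sum>j<n. nrm2 {..<n} (\<lambda>k. r k j))"
proof -
  let ?I = "{..<m} \<times> {..<n}" and ?K = "{..<n} \<times> {..<n}"
  define c where "c = (\<lambda>x. q x - \<tau> / real n)"
  define A where "A = (\<lambda>(k, l). r k l)"
  define P where "P = (\<lambda>x (k, l). bvec B x k * cnj (bvec B x l))"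
  define X where "X = (\<lambda>z. \<Sum>x\<in>?I. of_real (c x) * P x z)"
  \<comment> \<open>Each basis sees the whole trace, so the mean of \<open>q\<close> over any single
    basis is \<open>\<tau> / n\<close>.\<close>
  have c0: "(\<Sum>j<n. c (i, j)) = 0" if "i < m" for i
  proof -
    have "orthonormal_basis n (B i)" using mub that by (simp add: mutually_unbiased_def)
    from orthonormal_basis_trace[OF this, of r]
    have "(\<Sum>j<n. ip {..<n} (bvec B (i, j)) (mat_app n r (bvec B (i, j)))) = (of_real \<tau> :: complex)"
      by (simp add: tr bvec_def)
    moreover have "ip {..<n} (bvec B (i, j)) (mat_app n r (bvec B (i, j))) = of_real (q (i, j))"
      if "j \<in> {..<n}" for j
      by (rule q) (use that \<open>i < m\<close> in auto)
    ultimately have "(\<Sum>j<n. of_real (q (i, j))) = (of_real \<tau> :: complex)" by simp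
    then have "(\<Sum>j<n. q (i, j)) = \<tau>" by (metis of_real_eq_iff of_real_sum)
    then show ?thesis using n by (simp add: c_def sum_subtractf)
  qed
  have pairs: "(\<Sum>z\<in>?K. h z) = (\<Sum>k<n. \<Sum>l<n. h (k, l))" for h :: "nat \<times> nat \<Rightarrow> complex"
    by (simp add: sum.cartesian_product)
  have AP: "ip ?K A (P x) = of_real (q x)" if "x \<in> ?I" for x
  proof -
    have "ip ?K A (P x) = (\<Sum>k<n. \<Sum>l<n. r k l * (cnj (bvec B x k) * bvec B x l))"
      unfolding ip_def A_def P_def pairs by simp
    also have "\<dots> = ip {..<n} (mat_app n r (bvec B x)) (bvec B x)"
      unfolding ip_def mat_app_def sum_distrib_right by (simp add: mult_ac)
    also have "\<dots> = cnj (of_real (q x))" by (simp only: q[OF that, symmetric] ip_cnj)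
    finally show ?thesis by simp
  qed
  have PP: "ip ?K (P x) (P x') = of_real ((cmod (ip {..<n} (bvec B x) (bvec B x')))\<^sup>2)" for x x'
  proof -
    have "ip ?K (P x) (P x') = (\<Sum>k<n. \<Sum>l<n. bvec B x k * cnj (bvec B x' k) * cnj (bvec B x l * cnj (bvec B x' l)))"
      unfolding ip_def P_def pairs by (simp add: mult_ac)
    also have "\<dots> = ip {..<n} (bvec B x) (bvec B x') * cnj (ip {..<n} (bvec B x) (bvec B x'))"
      unfolding ip_def cnj_sum sum_product ..
    finally show ?thesis by (simp only: complex_norm_square)
  qed
  \<comment> \<open>A different basis contributes 1/n times the sum of \<open>c\<close> over it,
    which vanishes; the basis of \<open>x\<close> itself leaves only the diagonal term.\<close>
  have row: "(\<Sum>x'\<in>?I. c x' * (cmod (ip {..<n} (bvec B x) (bvec B x')))\<^sup>2) = c x" if x: "x \<in> ?I" for x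
  proof -
    obtain i j where ij: "x = (i, j)" "i < m" "j < n" using x by auto
    have "(\<Sum>x'\<in>?I. c x' * (cmod (ip {..<n} (bvec B x) (bvec B x')))\<^sup>2)
       = (\<Sum>i'<m. \<Sum>j'<n. c (i', j') * (if i = i' then (if j = j' then 1 else 0) else 1 / real n))"
      unfolding sum.cartesian_product
      by (intro sum.cong refl) (use mub_ip_bvec[OF mub x _ n] ij in auto)
    also have "\<dots> = (\<Sum>i'<m. if i = i' then c (i, j) else 0)"
    proof (intro sum.cong refl)
      fix i' assume "i' \<in> {..<m}"
      then have "i' < m" by simp
      then show "(\<Sum>j'<n. c (i', j') * (if i = i' then (if j = j' then 1 else 0) else 1 / real n))
          = (if i = i' then c (i, j) else 0)"
        using ij(3) c0[of i']
        by (cases "i = i'") (auto simp: sum_divide_distrib[symmetric] if_distrib[where f = "\<lambda>x. _ * x"] cong: if_cong)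
    qed
    also have "\<dots> = c x" using ij by simp
    finally show ?thesis .
  qed
  \<comment> \<open>The shift by \<open>\<tau> / n\<close> drops out because the coefficients sum to
    zero.\<close>
  have cq: "(\<Sum>x\<in>?I. c x * q x) = (\<Sum>x\<in>?I. (c x)\<^sup>2)"
  proof -
    have "(\<Sum>x\<in>?I. c x) = 0"
      using c0 by (simp add: sum.cartesian_product[where g = "\<lambda>i j. c (i, j)", simplified, symmetric])
    then have "(\<Sum>x\<in>?I. c x * (\<tau> / real n)) = 0" by (simp only: sum_distrib_right[symmetric] mult_zero_left)
    moreover have "(\<Sum>x\<in>?I. c x * q x) = (\<Sum>x\<in>?I. (c x)\<^sup>2) + (\<Sum>x\<in>?I. c x * (\<tau> / real n))"
    proof -
      have "c x * q x = (c x)\<^sup>2 + c x * (\<tau> / real n)" for x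
        by (simp add: c_def power2_eq_square right_diff_distrib)
      then show ?thesis by (simp only: sum.distrib)
    qed
    ultimately show ?thesis by simp
  qed
  have AX: "ip ?K A X = of_real (\<Sum>x\<in>?I. (c x)\<^sup>2)"
  proof -
    have "ip ?K A X = (\<Sum>x\<in>?I. of_real (c x) * ip ?K A (P x))"
      unfolding X_def by (simp only: ip_sum_right ip_scale_right complex_cnj_complex_of_real)
    also have "\<dots> = of_real (\<Sum>x\<in>?I. c x * q x)" using AP by simp
    finally show ?thesis by (simp only: cq)
  qed
  have XX: "ip ?K X X = of_real (\<Sum>x\<in>?I. (c x)\<^sup>2)"
  proof -
    have "ip ?K X X = (\<Sum>x\<in>?I. of_real (c x) * ip ?K (P x) X)"
      by (subst X_def) (simp only: ip_sum_left ip_scale_left)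
    also have "\<dots> = (\<Sum>x\<in>?I. of_real (c x) * of_real (c x))"
    proof (intro sum.cong refl arg_cong2[where f = times])
      fix x assume x: "x \<in> ?I"
      have "ip ?K (P x) X = (\<Sum>x'\<in>?I. of_real (c x') * ip ?K (P x) (P x'))"
        unfolding X_def by (simp only: ip_sum_right ip_scale_right complex_cnj_complex_of_real)
      also have "\<dots> = of_real (\<Sum>x'\<in>?I. c x' * (cmod (ip {..<n} (bvec B x) (bvec B x')))\<^sup>2)"
        by (simp only: PP of_real_sum of_real_mult)
      finally show "ip ?K (P x) X = of_real (c x)" by (simp only: row[OF x])
    qed
    finally show ?thesis by (simp add: power2_eq_square)
  qed
  have XA: "ip ?K X A = of_real (\<Sum>x\<in>?I. (c x)\<^sup>2)"
    by (metis AX ip_cnj complex_cnj_complex_of_real)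
  have "of_real (nrm2 ?K (\<lambda>z. A z - X z)) = (of_real (nrm2 ?K A - (\<Sum>x\<in>?I. (c x)\<^sup>2)) :: complex)"
    by (simp only: ip_self[symmetric] ip_diff_left ip_diff_right AX XA XX of_real_diff) simp
  then have "nrm2 ?K (\<lambda>z. A z - X z) = nrm2 ?K A - (\<Sum>x\<in>?I. (c x)\<^sup>2)"
    by (simp only: of_real_eq_iff)
  then have "(\<Sum>x\<in>?I. (c x)\<^sup>2) \<le> nrm2 ?K A"
    using nrm2_nonneg[of ?K "\<lambda>z. A z - X z"] by linarith
  also have "nrm2 ?K A = (\<Sum>k<n. \<Sum>j<n. (cmod (r k j))\<^sup>2)"
    unfolding nrm2_def A_def sum.cartesian_product by (rule sum.cong) auto
  also have "\<dots> = (\<Sum>j<n. nrm2 {..<n} (\<lambda>k. r k j))"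
    unfolding nrm2_def by (rule sum.swap)
  finally show ?thesis by (simp add: c_def)
qed

section \<open>Averaging over the sampled rows\<close>

lemma sum_PiE_insert:
  assumes "i \<notin> S"
  shows "(\<Sum>s\<in>PiE (insert i S) T. f s) = (\<Sum>g\<in>PiE S T. \<Sum>x\<in>T i. f (g(i := x)))"
proof -
  have "(\<Sum>s\<in>PiE (insert i S) T. f s) = (\<Sum>(x, g)\<in>T i \<times> PiE S T. f (g(i := x)))"
    unfolding PiE_insert_eq
    by (subst sum.reindex[OF inj_combinator[OF assms]]) (auto intro!: sum.cong)
  also have "\<dots> = (\<Sum>x\<in>T i. \<Sum>g\<in>PiE S T. f (g(i := x)))"
    by (simp add: sum.cartesian_product)
  also have "\<dots> = (\<Sum>g\<in>PiE S T. \<Sum>x\<in>T i. f (g(i := x)))" by (rule sum.swap)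
  finally show ?thesis .
qed

text \<open>Cauchy-Schwarz over the m n basis vectors turns the Bessel bound n/t^2 on the sum of
  squares into a mean absolute deviation of at most 1/(t sqrt m).\<close>

lemma mub_rquad_concentration:
  assumes mub: "mutually_unbiased n m B" and n: "0 < n" and m: "0 < m" and t: "0 < t"
  shows "(\<Sum>x\<in>{..<m} \<times> {..<n}. \<bar>rquad n t v S (bvec B x) - Re (rtrace n t v S) / real n\<bar>)
      \<le> real (m * n) / (t * sqrt (real m))"
proof -
  let ?I = "{..<m} \<times> {..<n}"
  define c where "c = (\<lambda>x. \<bar>rquad n t v S (bvec B x) - Re (rtrace n t v S) / real n\<bar>)"
  have "(\<Sum>x\<in>?I. (rquad n t v S (bvec B x) - Re (rtrace n t v S) / real n)\<^sup>2)
      \<le> (\<Sum>j<n. nrm2 {..<n} (\<lambda>k. resolv n t v S k j))"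
  proof (rule mub_bessel[OF mub n ip_resolv_self(1)[OF t]])
    show "(\<Sum>k<n. resolv n t v S k k) = of_real (Re (rtrace n t v S))"
      using rtrace_eq_rquad[OF t, of n v S] by (simp add: rtrace_def)
  qed
  also have "\<dots> \<le> real n / t\<^sup>2" by (rule nrm2_resolv_le[OF t])
  finally have c2: "(\<Sum>x\<in>?I. (c x)\<^sup>2) \<le> real n / t\<^sup>2" by (simp add: c_def)
  have "(\<Sum>x\<in>?I. c x)\<^sup>2 \<le> (\<Sum>x\<in>?I. (c x)\<^sup>2) * real (card ?I)"
    by (rule sum_squared_le_sum_of_squares)
  also have "\<dots> \<le> real n / t\<^sup>2 * real (m * n)"
    unfolding card_cartesian_product card_lessThan by (rule mult_right_mono[OF c2]) simp
  also have "\<dots> = (real (m * n) / (t * sqrt (real m)))\<^sup>2"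
  proof -
    have "(real (m * n) / (t * sqrt (real m)))\<^sup>2 = (real m * real n)\<^sup>2 / (t\<^sup>2 * real m)"
      by (simp add: power_divide power_mult_distrib)
    also have "\<dots> = real n / t\<^sup>2 * real (m * n)"
      using m t by (simp add: power2_eq_square)
    finally show ?thesis ..
  qed
  finally have "(\<Sum>x\<in>?I. c x) \<le> real (m * n) / (t * sqrt (real m))"
    by (rule power2_le_imp_le) (use t in simp)
  then show ?thesis by (simp add: c_def)
qed

definition svec :: "(nat \<Rightarrow> nat \<Rightarrow> complex Matrix.vec) \<Rightarrow> (nat \<Rightarrow> nat \<times> nat) \<Rightarrow> nat \<Rightarrow> nat \<Rightarrow> complex" where
  "svec B s i = bvec B (s i)"

lemma card_sample_space: "card (sample_space p m n) = (m * n) ^ p"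
  by (simp add: sample_space_def card_PiE)

text \<open>Row \<open>i\<close> is summed first with all other rows fixed. The resolvent leaves out
  row \<open>i\<close>, so it is constant in that inner sum and the bound for a fixed matrix
  applies.\<close>

lemma sum_rquad_deviation:
  assumes mub: "mutually_unbiased n m B" and n: "0 < n" and m: "0 < m" and t: "0 < t" and i: "i < p"
  shows "(\<Sum>s\<in>sample_space p m n. \<bar>rquad n t (svec B s) ({..<p} - {i}) (svec B s i)
            - Re (rtrace n t (svec B s) ({..<p} - {i})) / real n\<bar>)
      \<le> real (card (sample_space p m n)) / (t * sqrt (real m))"
proof -
  let ?S = "{..<p} - {i}" and ?D = "{..<m} \<times> {..<n}"
  have ins: "insert i ?S = {..<p}" using i by auto
  have upd: "rquad n t (svec B (g(i := x))) ?S (svec B (g(i := x)) i) = rquad n t (svec B g) ?S (bvec B x)"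
    "rtrace n t (svec B (g(i := x))) ?S = rtrace n t (svec B g) ?S" for g x
  proof -
    have "resolv n t (svec B (g(i := x))) ?S = resolv n t (svec B g) ?S"
      by (rule resolv_cong) (auto simp: svec_def)
    then show "rquad n t (svec B (g(i := x))) ?S (svec B (g(i := x)) i) = rquad n t (svec B g) ?S (bvec B x)"
      "rtrace n t (svec B (g(i := x))) ?S = rtrace n t (svec B g) ?S"
      by (simp_all add: rquad_def rtrace_def svec_def)
  qed
  have ss: "sample_space p m n = PiE (insert i ?S) (\<lambda>_. ?D)"
    by (simp only: ins sample_space_def)
  have "(\<Sum>s\<in>sample_space p m n. \<bar>rquad n t (svec B s) ?S (svec B s i) - Re (rtrace n t (svec B s) ?S) / real n\<bar>)
     = (\<Sum>g\<in>PiE ?S (\<lambda>_. ?D). \<Sum>x\<in>?D. \<bar>rquad n t (svec B g) ?S (bvec B x) - Re (rtrace n t (svec B g) ?S) / real n\<bar>)"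
    unfolding ss by (subst sum_PiE_insert) (simp_all only: upd Diff_iff insertI1 simp_thms not_True_eq_False)
  also have "\<dots> \<le> (\<Sum>g\<in>PiE ?S (\<lambda>_. ?D). real (m * n) / (t * sqrt (real m)))"
    by (intro sum_mono mub_rquad_concentration[OF mub n m t])
  also have "\<dots> = real (card (PiE ?S (\<lambda>_. ?D))) * real (m * n) / (t * sqrt (real m))" by simp
  also have "real (card (PiE ?S (\<lambda>_. ?D))) * real (m * n) = real (card (sample_space p m n))"
  proof -
    have "card (PiE ?S (\<lambda>_. ?D)) = (m * n) ^ (p - 1)" using i by (simp add: card_PiE)
    moreover have "(m * n) ^ p = (m * n) ^ (p - 1) * (m * n)" using i by (metis power_minus_mult gr_implies_not0 not_gr_zero)
    ultimately show ?thesis by (simp add: card_sample_space)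
  qed
  finally show ?thesis .
qed

section \<open>The Marchenko-Pastur law\<close>

text \<open>The antiderivative \<open>F\<close> is explicit. The argument of its first arcsin is the
  affine map taking A, B to -1, 1; the second is the negative of that map at A B / x, which also
  takes A, B to -1, 1. So each arcsin grows by pi over the interval, while the square root vanishes
  at both ends.\<close>

lemma sqrt_quadratic_over_x_integral:
  fixes A B :: real
  assumes A: "0 < A" and AB: "A < B"
  shows "((\<lambda>x. sqrt ((B - x) * (x - A)) / x) has_integral pi * ((A + B) / 2 - sqrt (A * B))) {A..B}"
proof -
  define F where "F = (\<lambda>x. sqrt ((B - x) * (x - A)) + (A + B) / 2 * arcsin ((2 * x - A - B) / (B - A))
     - sqrt (A * B) * arcsin (((A + B) * x - 2 * A * B) / (x * (B - A))))"
  have bnd1: "-1 \<le> (2 * x - A - B) / (B - A)" "(2 * x - A - B) / (B - A) \<le> 1"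
    if "A \<le> x" "x \<le> B" for x using that AB by (auto simp: field_simps)
  have bnd2: "-1 \<le> ((A + B) * x - 2 * A * B) / (x * (B - A))"
    "((A + B) * x - 2 * A * B) / (x * (B - A)) \<le> 1" if "A \<le> x" "x \<le> B" for x
  proof -
    have pos: "0 < x * (B - A)" using that A AB by simp
    have "- (x * (B - A)) \<le> (A + B) * x - 2 * A * B"
      using mult_left_mono[of A x "2 * B"] that A AB by (simp add: algebra_simps)
    then show "-1 \<le> ((A + B) * x - 2 * A * B) / (x * (B - A))"
      using pos by (simp add: pos_le_divide_eq)
    have "(A + B) * x - 2 * A * B \<le> x * (B - A)"
      using mult_left_mono[of x B "2 * A"] that A AB by (simp add: algebra_simps)
    then show "((A + B) * x - 2 * A * B) / (x * (B - A)) \<le> 1"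
      using pos by (simp add: pos_divide_le_eq)
  qed
  \<comment> \<open>At the endpoints the arcsin arguments are -1 and 1, where only continuity is
    available; derivatives are taken in the interior.\<close>
  have "((\<lambda>x. sqrt ((B - x) * (x - A)) / x) has_integral (F B - F A)) {A..B}"
  proof (rule fundamental_theorem_of_calculus_interior)
    show "A \<le> B" using AB by simp
    show "continuous_on {A..B} F"
      unfolding F_def using A AB bnd1 bnd2 by (auto intro!: continuous_intros)
    fix x assume x: "x \<in> {A<..<B}"
    then have x0: "0 < x" "A < x" "x < B" using A by auto
    define Q where "Q = (B - x) * (x - A)"
    have Q: "0 < Q" using x0 by (simp add: Q_def)
    \<comment> \<open>The radicands in both arcsin derivatives are squares of positive multiples of
      sqrt Q, so the roots come out explicitly.\<close>
    have e1: "1 - ((2 * x - A - B) / (B - A))\<^sup>2 = (2 * sqrt Q / (B - A))\<^sup>2"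
    proof -
      have "(2 * sqrt Q / (B - A))\<^sup>2 = 4 * Q / (B - A)\<^sup>2"
        using Q by (simp add: power_divide power_mult_distrib)
      moreover have "(B - A)\<^sup>2 - (2 * x - A - B)\<^sup>2 = 4 * Q"
        unfolding Q_def by (simp add: power2_eq_square algebra_simps)
      moreover have "(B - A)\<^sup>2 \<noteq> 0" using AB by simp
      ultimately show ?thesis by (simp add: power_divide divide_simps)
    qed
    have e2: "1 - (((A + B) * x - 2 * A * B) / (x * (B - A)))\<^sup>2 = (2 * sqrt (A * B) * sqrt Q / (x * (B - A)))\<^sup>2"
    proof -
      have "(2 * sqrt (A * B) * sqrt Q / (x * (B - A)))\<^sup>2 = 4 * (A * B) * Q / (x * (B - A))\<^sup>2"
        using Q A AB by (simp add: power_divide power_mult_distrib)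
      moreover have "(x * (B - A))\<^sup>2 - ((A + B) * x - 2 * A * B)\<^sup>2 = 4 * (A * B) * Q"
        unfolding Q_def by (simp add: power2_eq_square algebra_simps)
      moreover have "(x * (B - A))\<^sup>2 \<noteq> 0" using x0 AB by simp
      ultimately show ?thesis by (simp add: power_divide divide_simps)
    qed
    have s1: "sqrt (1 - ((2 * x - A - B) / (B - A))\<^sup>2) = 2 * sqrt Q / (B - A)"
      unfolding e1 using Q AB by (simp add: real_sqrt_abs)
    have s2: "sqrt (1 - (((A + B) * x - 2 * A * B) / (x * (B - A)))\<^sup>2) = 2 * sqrt (A * B) * sqrt Q / (x * (B - A))"
      unfolding e2 using Q AB A x0 by (simp add: real_sqrt_abs abs_mult)
    have l1: "-1 < (2 * x - A - B) / (B - A)" "(2 * x - A - B) / (B - A) < 1"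
      using x0 AB by (auto simp: field_simps)
    have p2: "0 < (2 * sqrt (A * B) * sqrt Q / (x * (B - A)))\<^sup>2"
      using Q A AB x0 by simp
    then have "(((A + B) * x - 2 * A * B) / (x * (B - A)))\<^sup>2 < 1"
      unfolding e2[symmetric] by simp
    then have "\<bar>((A + B) * x - 2 * A * B) / (x * (B - A))\<bar> < 1"
      unfolding abs_square_less_1 .
    then have l2: "-1 < ((A + B) * x - 2 * A * B) / (x * (B - A))"
       "((A + B) * x - 2 * A * B) / (x * (B - A)) < 1"
      by linarith+
    have d1: "((\<lambda>x. sqrt ((B - x) * (x - A))) has_real_derivative (A + B - 2 * x) / (2 * sqrt Q)) (at x)"
      using Q unfolding Q_def
      by (auto intro!: derivative_eq_intros simp: field_simps)
    have d2: "((\<lambda>x. arcsin ((2 * x - A - B) / (B - A))) has_real_derivative 1 / sqrt Q) (at x)"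
    proof -
      have "((\<lambda>x. (2 * x - A - B) / (B - A)) has_real_derivative 2 / (B - A)) (at x)"
        by (rule DERIV_cdivide) (auto intro!: derivative_eq_intros)
      from DERIV_chain2[OF DERIV_arcsin[OF l1] this]
      have "((\<lambda>x. arcsin ((2 * x - A - B) / (B - A))) has_real_derivative
          inverse (2 * sqrt Q / (B - A)) * (2 / (B - A))) (at x)"
        unfolding s1 .
      moreover have inv: "inverse (2 * s / d) * (2 / d) = 1 / s" if "d \<noteq> 0" for s d :: real
        using that by simp
      have "inverse (2 * sqrt Q / (B - A)) * (2 / (B - A)) = 1 / sqrt Q"
        by (rule inv) (use AB in simp)
      with calculation show ?thesis by (simp only:)
    qed
    have d3: "((\<lambda>x. arcsin (((A + B) * x - 2 * A * B) / (x * (B - A)))) has_real_derivative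
         sqrt (A * B) / (x * sqrt Q)) (at x)"
    proof -
      have "((\<lambda>x. ((A + B) * x - 2 * A * B) / (x * (B - A))) has_real_derivative
          2 * (sqrt (A * B) * sqrt (A * B)) / (x\<^sup>2 * (B - A))) (at x)"
        using AB A x0 by (auto intro!: derivative_eq_intros simp: divide_simps power2_eq_square)
          (auto simp: algebra_simps)
      from DERIV_chain2[OF DERIV_arcsin[OF l2] this]
      have "((\<lambda>x. arcsin (((A + B) * x - 2 * A * B) / (x * (B - A)))) has_real_derivative
          inverse (2 * sqrt (A * B) * sqrt Q / (x * (B - A))) * (2 * (sqrt (A * B) * sqrt (A * B)) / (x\<^sup>2 * (B - A)))) (at x)"
        unfolding s2 .
      moreover have inv: "inverse (2 * r * s / (x * d)) * (2 * (r * r) / (x\<^sup>2 * d)) = r / (x * s)"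
        if "d \<noteq> 0" "r \<noteq> 0" for r s d :: real
        using that x0(1) by (simp add: power2_eq_square)
      have "inverse (2 * sqrt (A * B) * sqrt Q / (x * (B - A))) * (2 * (sqrt (A * B) * sqrt (A * B)) / (x\<^sup>2 * (B - A)))
          = sqrt (A * B) / (x * sqrt Q)"
        by (rule inv) (use A AB in simp_all)
      with calculation show ?thesis by (simp only:)
    qed
    have "(F has_real_derivative (A + B - 2 * x) / (2 * sqrt Q) + (A + B) / 2 * (1 / sqrt Q)
        - sqrt (A * B) * (sqrt (A * B) / (x * sqrt Q))) (at x)"
      unfolding F_def by (intro DERIV_diff DERIV_add DERIV_cmult d1 d2 d3)
    also have "(A + B - 2 * x) / (2 * sqrt Q) + (A + B) / 2 * (1 / sqrt Q)
        - sqrt (A * B) * (sqrt (A * B) / (x * sqrt Q)) = sqrt Q / x"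
    proof -
      have "sqrt (A * B) * (sqrt (A * B) / (x * sqrt Q)) = A * B / (x * sqrt Q)"
        using A AB by simp
      moreover have "sqrt Q / x = Q / (x * sqrt Q)"
        using Q by (metis divide_divide_eq_left less_imp_le mult.commute real_div_sqrt)
      moreover have "(A + B - 2 * x) / (2 * sqrt Q) + (A + B) / 2 * (1 / sqrt Q) = (A + B - x) * x / (x * sqrt Q)"
        using Q x0 by (simp add: field_simps)
      moreover have "(A + B - x) * x - A * B = Q" by (simp add: Q_def algebra_simps)
      ultimately show ?thesis by (simp only: diff_divide_distrib[symmetric])
    qed
    finally show "(F has_vector_derivative sqrt ((B - x) * (x - A)) / x) (at x)"
      by (simp add: Q_def has_real_derivative_iff_has_vector_derivative)
  qed
  moreover have "F B - F A = pi * ((A + B) / 2 - sqrt (A * B))"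
  proof -
    have "(2 * B - A - B) / (B - A) = 1" "(2 * A - A - B) / (B - A) = -1"
      "((A + B) * B - 2 * A * B) / (B * (B - A)) = 1" "((A + B) * A - 2 * A * B) / (A * (B - A)) = -1"
      using A AB by (auto simp: field_simps)
    then show ?thesis unfolding F_def by (simp add: algebra_simps)
  qed
  ultimately show ?thesis by simp
qed

definition mp_measure :: "real \<Rightarrow> real measure" where
  "mp_measure y = density lborel (\<lambda>x. ennreal (mp_density y x))"

section \<open>The Marchenko-Pastur density as a probability measure\<close>

context
  fixes y a b :: real
  assumes y: "0 < y" "y < 1"
  defines "a \<equiv> (1 - sqrt y)\<^sup>2" and "b \<equiv> (1 + sqrt y)\<^sup>2"
begin

lemma mp_edges: "0 < a" "a < b" "a + b = 2 * (1 + y)" "a * b = (1 - y)\<^sup>2"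
proof -
  have s: "0 < sqrt y" "sqrt y < 1" "(sqrt y)\<^sup>2 = y" using y by auto
  show "0 < a" using s by (simp add: a_def)
  show "a < b" using s by (simp add: a_def b_def power2_eq_square algebra_simps)
  show "a + b = 2 * (1 + y)" using s(3) by (simp add: a_def b_def power2_eq_square algebra_simps)
  have "(1 - r)\<^sup>2 * (1 + r)\<^sup>2 = (1 - r\<^sup>2)\<^sup>2" for r :: real by (simp add: power2_eq_square algebra_simps)
  then have "a * b = (1 - (sqrt y)\<^sup>2)\<^sup>2" unfolding a_def b_def .
  then show "a * b = (1 - y)\<^sup>2" using s(3) by simp
qed

lemma mp_density_alt: "mp_density y x = indicator {a..b} x * (sqrt ((b - x) * (x - a)) / (2 * pi * x * y))"
  by (simp add: mp_density_def a_def b_def Let_def)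

lemma mp_density_nonneg: "0 \<le> mp_density y x"
  unfolding mp_density_alt using mp_edges y by (auto simp: indicator_def)

lemma mp_density_measurable [measurable]: "mp_density y \<in> borel_measurable borel"
  unfolding mp_density_alt[abs_def] by measurable

text \<open>Translation by \<open>c\<close> moves the edges to a + c and b + c, and the radicand is
  the product of the new edges. The case c = 0 gives the total mass; c = t enters the Stieltjes
  transform.\<close>

lemma mp_shifted_integral:
  assumes "0 \<le> c"
  shows "((\<lambda>x. sqrt ((b - x) * (x - a)) / (x + c)) has_integral
     pi * ((1 + y) + c - sqrt ((1 - y + c)\<^sup>2 + 4 * y * c))) {a..b}"
proof -
  have "((\<lambda>x. sqrt ((b + c - x) * (x - (a + c))) / x) has_integral
     pi * (((a + c) + (b + c)) / 2 - sqrt ((a + c) * (b + c)))) {a + c..b + c}"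
    using sqrt_quadratic_over_x_integral[of "a + c" "b + c"] mp_edges assms by simp
  from this[folded has_integral_shift_Icc_real]
  have "((\<lambda>x. sqrt ((b - x) * (x - a)) / (x + c)) has_integral
     pi * (((a + c) + (b + c)) / 2 - sqrt ((a + c) * (b + c)))) {a..b}"
    by (simp add: o_def algebra_simps)
  moreover have "((a + c) + (b + c)) / 2 = 1 + y + c" using mp_edges(3) by (simp add: field_simps)
  moreover have "(a + c) * (b + c) = (1 - y + c)\<^sup>2 + 4 * y * c"
  proof -
    have "(a + c) * (b + c) = a * b + c * (a + b) + c\<^sup>2" by (simp add: power2_eq_square algebra_simps)
    then show ?thesis unfolding mp_edges by (simp add: power2_eq_square algebra_simps)
  qed
  ultimately show ?thesis by (simp only:)
qed

text \<open>Nonnegativity of \<open>f\<close> allows the passage from the gauge integral through the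
  nonnegative Lebesgue integral; 2 pi y is the normalisation in the density.\<close>

lemma mp_has_integral:
  assumes f: "((\<lambda>x. f x * (sqrt ((b - x) * (x - a)) / x)) has_integral I) {a..b}"
    and nn: "\<And>x. x \<in> {a..b} \<Longrightarrow> 0 \<le> f x" and [measurable]: "f \<in> borel_measurable borel"
  shows "has_bochner_integral (mp_measure y) f (I / (2 * pi * y))"
proof -
  have "((\<lambda>x. 1 / (2 * pi * y) * (f x * (sqrt ((b - x) * (x - a)) / x))) has_integral 1 / (2 * pi * y) * I) {a..b}"
    by (rule has_integral_mult_right[OF f])
  then have "((\<lambda>x. if x \<in> {a..b} then 1 / (2 * pi * y) * (f x * (sqrt ((b - x) * (x - a)) / x)) else 0)
      has_integral I / (2 * pi * y)) UNIV"
    unfolding has_integral_restrict_UNIV by simp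
  also have "(\<lambda>x. if x \<in> {a..b} then 1 / (2 * pi * y) * (f x * (sqrt ((b - x) * (x - a)) / x)) else 0)
     = (\<lambda>x. mp_density y x * f x)"
    by (auto simp: mp_density_alt indicator_def fun_eq_iff mult_ac)
  finally have "((\<lambda>x. mp_density y x * f x) has_integral I / (2 * pi * y)) UNIV" .
  moreover have "0 \<le> mp_density y x * f x" for x
  proof (cases "x \<in> {a..b}")
    case True
    then show ?thesis using nn mp_density_nonneg by (intro mult_nonneg_nonneg) auto
  qed (simp add: mp_density_alt)
  ultimately have "has_bochner_integral lborel (\<lambda>x. mp_density y x * f x) (I / (2 * pi * y))"
    by (intro has_bochner_integral_nn_integral nn_integral_has_integral_lborel) 
       (auto intro: has_integral_nonneg)
  then show ?thesis unfolding mp_measure_def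
    by (intro has_bochner_integral_density) (auto simp: mp_density_nonneg)
qed

text \<open>At c = 0 the shifted integral is pi ((1 + y) - (1 - y)) = 2 pi y, where y < 1 resolves
  the square root of (1 - y)^2.\<close>

lemma mp_prob_space: "prob_space (mp_measure y)"
proof -
  have "((\<lambda>x. 1 * (sqrt ((b - x) * (x - a)) / x)) has_integral pi * (2 * y)) {a..b}"
    using mp_shifted_integral[of 0] y by simp
  from mp_has_integral[OF this] have "has_bochner_integral (mp_measure y) (\<lambda>_. 1 :: real) 1"
    using y by simp
  then have i: "integrable (mp_measure y) (\<lambda>_. 1 :: real)" and e: "integral\<^sup>L (mp_measure y) (\<lambda>_. 1) = (1 :: real)"
    by (auto simp: has_bochner_integral_iff)
  have "emeasure (mp_measure y) (space (mp_measure y)) \<noteq> \<infinity>"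
    using i by (simp add: integrable_iff_bounded)
  then have "finite_measure (mp_measure y)" by (rule finite_measureI)
  moreover have "measure (mp_measure y) (space (mp_measure y)) = 1"
    using e by simp
  ultimately show ?thesis
    by (metis finite_measure.emeasure_eq_measure ennreal_1 prob_spaceI)
qed

text \<open>By partial fractions 1 / (x (x + t)) is (1/x - 1/(x + t)) / t, so the transform is a
  difference of two shifted integrals.\<close>

lemma mp_stieltjes:
  assumes t: "0 < t"
  shows "integral\<^sup>L (mp_measure y) (\<lambda>x. 1 / (x + t))
      = (y - 1 - t + sqrt ((1 - y + t)\<^sup>2 + 4 * y * t)) / (2 * t * y)"
proof -
  define D where "D = sqrt ((1 - y + t)\<^sup>2 + 4 * y * t)"
  have "((\<lambda>x. 1 / t * (sqrt ((b - x) * (x - a)) / (x + 0) - sqrt ((b - x) * (x - a)) / (x + t)))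
      has_integral 1 / t * (pi * ((1 + y) + 0 - sqrt ((1 - y + 0)\<^sup>2 + 4 * y * 0)) - pi * ((1 + y) + t - D))) {a..b}"
    unfolding D_def using t by (intro has_integral_mult_right has_integral_diff mp_shifted_integral) auto
  also have "1 / t * (pi * ((1 + y) + 0 - sqrt ((1 - y + 0)\<^sup>2 + 4 * y * 0)) - pi * ((1 + y) + t - D))
     = pi * (y - 1 - t + D) / t"
    using y t by (simp add: field_simps)
  finally have *: "((\<lambda>x. 1 / t * (sqrt ((b - x) * (x - a)) / (x + 0) - sqrt ((b - x) * (x - a)) / (x + t)))
      has_integral pi * (y - 1 - t + D) / t) {a..b}" .
  have eq: "1 / t * (u / (x + 0) - u / (x + t)) = 1 / (x + t) * (u / x)" if "a \<le> x" for u x :: real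
    using that t mp_edges(1) by (simp add: field_simps)
  have "((\<lambda>x. 1 / (x + t) * (sqrt ((b - x) * (x - a)) / x)) has_integral pi * (y - 1 - t + D) / t) {a..b}"
    by (rule has_integral_eq[OF _ *]) (use eq in auto)
  from mp_has_integral[OF this] have "has_bochner_integral (mp_measure y) (\<lambda>x. 1 / (x + t))
       (pi * (y - 1 - t + D) / t / (2 * pi * y))"
    using mp_edges(1) t by auto
  then show ?thesis
    unfolding D_def[symmetric] using y t
    by (simp add: has_bochner_integral_iff)
qed

lemma AE_mp_nonneg: "AE x in mp_measure y. 0 \<le> x"
  unfolding mp_measure_def
  using mp_edges(1) by (subst AE_density) (auto simp: mp_density_alt indicator_def)

lemma mp_cdf_eq: "mp_cdf y x = integral\<^sup>L (mp_measure y) (indicator {..x})"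
  unfolding mp_measure_def mp_cdf_def
  by (subst integral_density) (auto simp: mp_density_nonneg mult.commute)

text \<open>Absence of atoms is what closes the sandwich of an indicator at its jump.\<close>

lemma AE_mp_neq: "AE x in mp_measure y. x \<noteq> c"
  unfolding mp_measure_def
  by (subst AE_density) (use AE_lborel_singleton[of c] in auto)

lemma sets_mp_measure [measurable_cong, simp]: "sets (mp_measure y) = sets borel"
  by (simp add: mp_measure_def)

end

section \<open>The self-consistent equation\<close>

lemma shrink_diff:
  fixes a b :: real
  assumes "0 \<le> a" "0 \<le> b"
  shows "a / (1 + a) - b / (1 + b) = (a - b) / ((1 + a) * (1 + b))"
proof -
  have "1 + a \<noteq> 0" "1 + b \<noteq> 0" using assms by auto
  then show ?thesis by (simp add: divide_simps) (simp add: algebra_simps)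
qed

lemma shrink_lipschitz:
  fixes a b :: real
  assumes "0 \<le> a" "0 \<le> b"
  shows "\<bar>a / (1 + a) - b / (1 + b)\<bar> \<le> \<bar>a - b\<bar>"
proof -
  have "1 * 1 \<le> (1 + a) * (1 + b)" using assms by (intro mult_mono) auto
  then have "\<bar>a - b\<bar> / ((1 + a) * (1 + b)) \<le> \<bar>a - b\<bar> / 1"
    by (intro divide_left_mono) auto
  then show ?thesis using assms by (simp add: shrink_diff abs_mult)
qed

text \<open>The nonnegative root \<open>g\<close> of \<open>t g + y g / (1 + g) = 1\<close>.\<close>

definition mp_companion :: "real \<Rightarrow> real \<Rightarrow> real" where
  "mp_companion y t = (1 - t - y + sqrt ((1 - y + t)\<^sup>2 + 4 * y * t)) / (2 * t)"

text \<open>Clearing the denominator gives t g^2 - (1 - t - y) g - 1 = 0, and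
  \<open>mp_companion\<close> is the larger root.\<close>

lemma mp_companion_fixpoint:
  assumes t: "0 < t" and y: "0 < y"
  shows "0 \<le> mp_companion y t"
    and "t * mp_companion y t + y * (mp_companion y t / (1 + mp_companion y t)) = 1"
proof -
  define D where "D = sqrt ((1 - y + t)\<^sup>2 + 4 * y * t)"
  define g where "g = mp_companion y t"
  \<comment> \<open>The radicand of the Marchenko-Pastur transform is the discriminant of this
    quadratic; in the second form it is visibly at least (1 - t - y)^2, which makes the root
    nonnegative.\<close>
  have eqD: "(1 - y + t)\<^sup>2 + 4 * y * t = (1 - t - y)\<^sup>2 + 4 * t"
    by (simp add: power2_eq_square algebra_simps)
  have D2: "D\<^sup>2 = (1 - t - y)\<^sup>2 + 4 * t"
    unfolding D_def eqD using t by (simp add: add_nonneg_nonneg)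
  have "\<bar>1 - t - y\<bar> \<le> D"
    unfolding D_def eqD using t by (intro real_le_rsqrt) simp
  then have "0 \<le> 1 - t - y + D" by linarith
  then show g0: "0 \<le> mp_companion y t"
    unfolding mp_companion_def D_def[symmetric] using t by simp
  have gD: "2 * t * g = 1 - t - y + D"
    unfolding g_def mp_companion_def D_def[symmetric] using t by simp
  have "(2 * t * g - (1 - t - y))\<^sup>2 = (1 - t - y)\<^sup>2 + 4 * t"
    unfolding gD using D2 by simp
  then have "4 * t * (t * g * g - (1 - t - y) * g - 1) = 0"
    by (simp add: power2_eq_square algebra_simps)
  then have "t * g * g - (1 - t - y) * g - 1 = 0" using t by simp
  then have "t * g * (1 + g) + y * g = 1 + g" by (simp add: algebra_simps)
  moreover have "1 + g \<noteq> 0" using g0 by (simp add: g_def)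
  ultimately have "t * g + y * (g / (1 + g)) = 1" by (simp add: divide_simps)
  then show "t * mp_companion y t + y * (mp_companion y t / (1 + mp_companion y t)) = 1"
    by (simp only: g_def)
qed

text \<open>The secant slope of g -> t g + y g / (1 + g) is t + y / ((1 + g) (1 + h)), hence at
  least t.\<close>

lemma companion_stability:
  fixes g h t y :: real
  assumes "0 \<le> g" "0 \<le> h" "0 \<le> y" "0 < t"
  shows "t * \<bar>g - h\<bar> \<le> \<bar>(t * g + y * (g / (1 + g))) - (t * h + y * (h / (1 + h)))\<bar>"
proof -
  let ?c = "1 / ((1 + g) * (1 + h))"
  have "(t * g + y * (g / (1 + g))) - (t * h + y * (h / (1 + h))) = t * (g - h) + y * (g / (1 + g) - h / (1 + h))"
    by (simp add: right_diff_distrib)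
  also have "\<dots> = (t + y * ?c) * (g - h)"
    unfolding shrink_diff[OF assms(1,2)] by (simp add: algebra_simps)
  finally have "\<bar>(t * g + y * (g / (1 + g))) - (t * h + y * (h / (1 + h)))\<bar> = (t + y * ?c) * \<bar>g - h\<bar>"
    using assms by (simp add: abs_mult)
  moreover have "t * \<bar>g - h\<bar> \<le> (t + y * ?c) * \<bar>g - h\<bar>"
    using assms by (intro mult_right_mono) auto
  ultimately show ?thesis by simp
qed

text \<open>The trace identity is the self-consistent equation with \<open>q i\<close> in place of
  g. Replacing \<open>q i\<close> by g costs its deviation from the leave-one-out trace plus 1/(t n)
  for restoring the row; \<open>companion_stability\<close> converts the defect into a distance,
  whence the factor t on the left.\<close>

lemma rtrace_pointwise:
  assumes n: "0 < n" and t: "0 < t" and y: "0 < y" and p: "real p = y * real n"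
  shows "t * \<bar>Re (rtrace n t v {..<p}) / real n - mp_companion y t\<bar>
     \<le> (\<Sum>i<p. \<bar>rquad n t v ({..<p} - {i}) (v i) - Re (rtrace n t v ({..<p} - {i})) / real n\<bar> + 1 / (t * real n)) / real n"
proof -
  define g where "g = Re (rtrace n t v {..<p}) / real n"
  define q where "q = (\<lambda>i. rquad n t v ({..<p} - {i}) (v i))"
  have q0: "0 \<le> q i" for i unfolding q_def by (rule rquad_nonneg[OF t])
  have tr: "Re (rtrace n t v S) = (\<Sum>k<n. rquad n t v S (stdb k))" for S
    by (simp only: rtrace_eq_rquad[OF t] Re_complex_of_real)
  have g0: "0 \<le> g"
    unfolding g_def tr by (intro divide_nonneg_nonneg sum_nonneg rquad_nonneg[OF t]) simp
  have ins: "insert i ({..<p} - {i}) = {..<p}" if "i < p" for i using that by auto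
  have "t * Re (rtrace n t v {..<p}) + (\<Sum>i<p. rquad n t v {..<p} (v i)) = real n"
    using arg_cong[OF rtrace_identity[OF t, of n v "{..<p}"], of Re] by simp
  moreover have "rquad n t v {..<p} (v i) = q i / (1 + q i)" if "i < p" for i
    using rquad_insert[OF t, of "{..<p} - {i}" i n v] unfolding ins[OF that] q_def by simp
  ultimately have "t * Re (rtrace n t v {..<p}) + (\<Sum>i<p. q i / (1 + q i)) = real n" by simp
  then have id: "t * g + (\<Sum>i<p. q i / (1 + q i)) / real n = 1"
    using n by (simp add: g_def field_simps)
  have "t * \<bar>g - mp_companion y t\<bar> \<le> \<bar>(t * g + y * (g / (1 + g))) - 1\<bar>"
    using companion_stability[OF g0 mp_companion_fixpoint(1)[OF t y], of y t] mp_companion_fixpoint(2)[OF t y] y t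
    by simp
  also have "(t * g + y * (g / (1 + g))) - 1 = (\<Sum>i<p. g / (1 + g) - q i / (1 + q i)) / real n"
  proof -
    have "y * (g / (1 + g)) = (\<Sum>i<p. g / (1 + g)) / real n"
      using p n by simp
    moreover have "(\<Sum>i<p. g / (1 + g) - q i / (1 + q i)) / real n
        = (\<Sum>i<p. g / (1 + g)) / real n - (\<Sum>i<p. q i / (1 + q i)) / real n"
      by (simp only: sum_subtractf diff_divide_distrib)
    ultimately show ?thesis using id by linarith
  qed
  also have "\<bar>(\<Sum>i<p. g / (1 + g) - q i / (1 + q i)) / real n\<bar>
      \<le> (\<Sum>i<p. \<bar>q i - Re (rtrace n t v ({..<p} - {i})) / real n\<bar> + 1 / (t * real n)) / real n"
  proof -
    have "\<bar>g / (1 + g) - q i / (1 + q i)\<bar> \<le> \<bar>q i - Re (rtrace n t v ({..<p} - {i})) / real n\<bar> + 1 / (t * real n)"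
      if i: "i < p" for i
    proof -
      have "cmod (rtrace n t v ({..<p} - {i}) - rtrace n t v {..<p}) \<le> 1 / t"
        using rtrace_insert[OF t, of "{..<p} - {i}" i n v] unfolding ins[OF i] by simp
      then have "\<bar>Re (rtrace n t v ({..<p} - {i})) - Re (rtrace n t v {..<p})\<bar> \<le> 1 / t"
        using abs_Re_le_cmod[of "rtrace n t v ({..<p} - {i}) - rtrace n t v {..<p}"] by simp
      then have "\<bar>Re (rtrace n t v ({..<p} - {i})) - Re (rtrace n t v {..<p})\<bar> / real n \<le> 1 / t / real n"
        by (rule divide_right_mono) simp
      then have "\<bar>Re (rtrace n t v ({..<p} - {i})) / real n - g\<bar> \<le> 1 / (t * real n)"
        unfolding g_def diff_divide_distrib[symmetric] by (simp add: abs_divide)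
      then show ?thesis using shrink_lipschitz[OF g0 q0[of i]] by linarith
    qed
    then have "(\<Sum>i<p. \<bar>g / (1 + g) - q i / (1 + q i)\<bar>)
       \<le> (\<Sum>i<p. \<bar>q i - Re (rtrace n t v ({..<p} - {i})) / real n\<bar> + 1 / (t * real n))"
      by (intro sum_mono) auto
    then have "\<bar>\<Sum>i<p. g / (1 + g) - q i / (1 + q i)\<bar>
       \<le> (\<Sum>i<p. \<bar>q i - Re (rtrace n t v ({..<p} - {i})) / real n\<bar> + 1 / (t * real n))"
      using sum_abs[of "\<lambda>i. g / (1 + g) - q i / (1 + q i)" "{..<p}"] by linarith
    then have "\<bar>\<Sum>i<p. g / (1 + g) - q i / (1 + q i)\<bar> / real n
       \<le> (\<Sum>i<p. \<bar>q i - Re (rtrace n t v ({..<p} - {i})) / real n\<bar> + 1 / (t * real n)) / real n"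
      by (rule divide_right_mono) simp
    then show ?thesis by (simp add: abs_divide)
  qed
  finally show ?thesis by (simp only: g_def q_def)
qed

text \<open>In y/t^2 one factor 1/t comes from stability and one from the row estimates, while y =
  p/n counts rows per dimension.\<close>

lemma rtrace_L1:
  assumes mub: "mutually_unbiased n m B" and n: "0 < n" and m: "0 < m" and t: "0 < t" and y: "0 < y"
    and p: "real p = y * real n"
  shows "(\<Sum>s\<in>sample_space p m n. \<bar>Re (rtrace n t (svec B s) {..<p}) / real n - mp_companion y t\<bar>)
      \<le> real (card (sample_space p m n)) * (y / t\<^sup>2 * (1 / sqrt (real m) + 1 / real n))"
proof -
  let ?\<Omega> = "sample_space p m n"
  define d where "d = (\<lambda>s i. \<bar>rquad n t (svec B s) ({..<p} - {i}) (svec B s i)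
       - Re (rtrace n t (svec B s) ({..<p} - {i})) / real n\<bar>)"
  have "t * (\<Sum>s\<in>?\<Omega>. \<bar>Re (rtrace n t (svec B s) {..<p}) / real n - mp_companion y t\<bar>)
     \<le> (\<Sum>s\<in>?\<Omega>. (\<Sum>i<p. d s i + 1 / (t * real n)) / real n)"
    unfolding sum_distrib_left d_def by (intro sum_mono rtrace_pointwise[OF n t y p])
  also have "\<dots> = (\<Sum>i<p. \<Sum>s\<in>?\<Omega>. d s i + 1 / (t * real n)) / real n"
    unfolding sum_divide_distrib[symmetric] by (subst sum.swap) (rule refl)
  also have "\<dots> \<le> (\<Sum>i<p. real (card ?\<Omega>) / (t * sqrt (real m)) + real (card ?\<Omega>) / (t * real n)) / real n"
  proof (intro divide_right_mono sum_mono)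
    fix i assume "i \<in> {..<p}"
    then have "(\<Sum>s\<in>?\<Omega>. d s i) \<le> real (card ?\<Omega>) / (t * sqrt (real m))"
      unfolding d_def by (intro sum_rquad_deviation[OF mub n m t]) simp
    then show "(\<Sum>s\<in>?\<Omega>. d s i + 1 / (t * real n))
        \<le> real (card ?\<Omega>) / (t * sqrt (real m)) + real (card ?\<Omega>) / (t * real n)"
      by (simp add: sum.distrib)
  qed simp
  also have "\<dots> = y * (real (card ?\<Omega>) / (t * sqrt (real m)) + real (card ?\<Omega>) / (t * real n))"
    using p n by simp
  also have "\<dots> = t * (real (card ?\<Omega>) * (y / t\<^sup>2 * (1 / sqrt (real m) + 1 / real n)))"
    using t by (simp add: power2_eq_square algebra_simps)
  finally show ?thesis using t by (simp only: mult_le_cancel_left_pos)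
qed

section \<open>The spectrum of the Gram matrix\<close>

lemma order_prod_linear:
  fixes es :: "'a :: idom list"
  shows "Polynomial.order z (\<Prod>a\<leftarrow>es. [:- a, 1:]) = count_list es z"
proof (induction es)
  case (Cons a es)
  have "(\<Prod>a\<leftarrow>es. [:- a, 1:]) \<noteq> 0" by (auto simp: prod_list_zero_iff)
  moreover have "Polynomial.order z [:- a, 1:] = (if a = z then 1 else 0)"
    using order_power_n_n[of a 1] by (auto simp: order_root intro: order_0I)
  ultimately show ?case using Cons by (simp add: order_mult del: mult_pCons_left)
qed simp

text \<open>\<open>esd\<close> weights distinct roots by their order, which for a split polynomial
  is the count in the root list. Reality of the roots ensures that the filter on \<open>Im\<close>
  loses none.\<close>

lemma esd_eq_eigenvalue_count:
  assumes A: "A \<in> carrier_mat p p" and es: "char_poly A = (\<Prod>a\<leftarrow>es. [:- a, 1:])" "length es = p"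
    and real: "\<And>e. e \<in> set es \<Longrightarrow> Im e = 0"
  shows "esd A x = (\<Sum>i<p. indicator {..x} (Re (es ! i))) / real p"
proof -
  have "{z. poly (char_poly A) z = 0 \<and> Im z = 0 \<and> Re z \<le> x} = {z \<in> set es. Re z \<le> x}"
    unfolding es by (auto simp: poly_prod_list prod_list_zero_iff real image_iff)
  then have "(\<Sum>z\<in>{z. poly (char_poly A) z = 0 \<and> Im z = 0 \<and> Re z \<le> x}. Polynomial.order z (char_poly A))
     = (\<Sum>z\<in>{z \<in> set es. Re z \<le> x}. count_list es z)"
    unfolding es by (simp only: order_prod_linear)
  also have "\<dots> = (\<Sum>z\<in>set es. count_list es z * of_bool (Re z \<le> x))"
    by (subst sum.inter_filter) (simp, rule sum.cong, simp_all)
  also have "\<dots> = sum_list (map (\<lambda>z. of_bool (Re z \<le> x)) es)"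
    by (rule sum_list_map_eq_sum_count[symmetric])
  also have "\<dots> = (\<Sum>i<p. of_bool (Re (es ! i) \<le> x))"
    by (simp add: sum_list_sum_nth es(2) atLeast0LessThan)
  finally show ?thesis
    using A by (simp add: esd_def indicator_def)
qed

lemma trace_mult_commute:
  assumes "A \<in> carrier_mat p p" "C \<in> carrier_mat p p"
  shows "(\<Sum>i<p. (A * C) $$ (i, i)) = (\<Sum>i<p. (C * A) $$ (i, i) :: complex)"
proof -
  have "(\<Sum>i<p. (A * C) $$ (i, i)) = (\<Sum>i<p. \<Sum>k<p. A $$ (i, k) * C $$ (k, i))"
    using assms by (simp add: times_mat_def scalar_prod_def atLeast0LessThan)
  also have "\<dots> = (\<Sum>k<p. \<Sum>i<p. A $$ (i, k) * C $$ (k, i))" by (rule sum.swap)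
  also have "\<dots> = (\<Sum>i<p. (C * A) $$ (i, i))"
    using assms by (simp add: times_mat_def scalar_prod_def atLeast0LessThan mult.commute)
  finally show ?thesis .
qed

text \<open>The inverse is again upper triangular, shown row by row from the bottom; a diagonal
  entry of U V = 1 then has a single term.\<close>

lemma upper_triangular_inverse_diag:
  fixes U V :: "complex mat"
  assumes U: "U \<in> carrier_mat p p" and V: "V \<in> carrier_mat p p"
    and ut: "upper_triangular U" and nz: "\<And>i. i < p \<Longrightarrow> U $$ (i, i) \<noteq> 0"
    and inv: "U * V = 1\<^sub>m p" and i: "i < p"
  shows "V $$ (i, i) = 1 / U $$ (i, i)"
proof -
  have ent: "(\<Sum>k<p. U $$ (i, k) * V $$ (k, j)) = (if i = j then 1 else 0)" if "i < p" "j < p" for i j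
    using arg_cong[OF inv, of "\<lambda>M. M $$ (i, j)"] U V that
    by (simp add: times_mat_def scalar_prod_def atLeast0LessThan)
  have step: "(\<Sum>k<p. U $$ (i, k) * V $$ (k, j)) = U $$ (i, i) * V $$ (i, j)"
    if ij: "i < p" "j < p" and z: "\<And>k. i < k \<Longrightarrow> k < p \<Longrightarrow> V $$ (k, j) = 0" for i j
  proof -
    have "(\<Sum>k<p. U $$ (i, k) * V $$ (k, j)) = (\<Sum>k\<in>{i}. U $$ (i, k) * V $$ (k, j))"
    proof (intro sum.mono_neutral_right ballI)
      fix k assume "k \<in> {..<p} - {i}"
      then consider "k < i" | "i < k" "k < p" by fastforce
      then show "U $$ (i, k) * V $$ (k, j) = 0"
        using ut U ij z by cases (auto simp: upper_triangular_def)
    qed (use ij in auto)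
    then show ?thesis by simp
  qed
  have low: "V $$ (k, j) = 0" if "j < k" "k < p" for j k
    using that
  proof (induction "p - k" arbitrary: k rule: less_induct)
    case less
    have "V $$ (l, j) = 0" if "k < l" "l < p" for l
      using less.hyps[of l] less.prems that by auto
    then have "U $$ (k, k) * V $$ (k, j) = 0"
      using step[of k j] ent[of k j] less.prems by simp
    then show ?case using nz[OF less.prems(2)] by simp
  qed
  have "U $$ (i, i) * V $$ (i, i) = 1"
    using step[OF i i] ent[OF i i] low i by simp
  then show ?thesis using nz[OF i] by (simp add: field_simps)
qed

text \<open>A Schur decomposition A = P U Q turns A + c into P (U + c) Q, so Q S P inverts a
  triangular matrix with diagonal \<open>es ! i + c\<close>; conjugation preserves the
  trace.\<close>

lemma trace_inverse_eq_sum_eigenvalues: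
  fixes A S :: "complex mat"
  assumes A: "A \<in> carrier_mat p p" and S: "S \<in> carrier_mat p p"
    and es: "char_poly A = (\<Prod>a\<leftarrow>es. [:- a, 1:])" "length es = p"
    and nz: "\<And>e. e \<in> set es \<Longrightarrow> e + c \<noteq> 0"
    and inv: "(A + c \<cdot>\<^sub>m 1\<^sub>m p) * S = 1\<^sub>m p"
  shows "(\<Sum>i<p. S $$ (i, i)) = (\<Sum>i<p. 1 / (es ! i + c))"
proof -
  obtain U P Q where d: "schur_decomposition A es = (U, P, Q)" by (cases "schur_decomposition A es") auto
  have sim: "similar_mat_wit A U P Q" and ut: "upper_triangular U" and dg: "diag_mat U = es"
    using schur_decomposition[OF A es(1) d] by auto
  note w = similar_mat_witD2[OF A sim]
  have U: "U \<in> carrier_mat p p" and P: "P \<in> carrier_mat p p" and Q: "Q \<in> carrier_mat p p"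
    and PQ: "P * Q = 1\<^sub>m p" and QP: "Q * P = 1\<^sub>m p" and AU: "A = P * U * Q" using w by auto
  define M where "M = U + c \<cdot>\<^sub>m 1\<^sub>m p"
  have M: "M \<in> carrier_mat p p" using U by (simp add: M_def)
  have Udiag: "U $$ (i, i) = es ! i" if "i < p" for i
    using dg U that by (auto simp: diag_mat_def)
  have AM: "A + c \<cdot>\<^sub>m 1\<^sub>m p = P * M * Q"
  proof -
    have "P * M * Q = (P * U + P * (c \<cdot>\<^sub>m 1\<^sub>m p)) * Q"
      unfolding M_def using U P by (subst mult_add_distrib_mat) auto
    also have "\<dots> = P * U * Q + P * (c \<cdot>\<^sub>m 1\<^sub>m p) * Q"
      using U P Q by (intro add_mult_distrib_mat) auto
    also have "P * (c \<cdot>\<^sub>m 1\<^sub>m p) = c \<cdot>\<^sub>m P"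
      using mult_smult_distrib[OF P, of "1\<^sub>m p" p c] P by simp
    also have "c \<cdot>\<^sub>m P * Q = c \<cdot>\<^sub>m 1\<^sub>m p"
      using P Q PQ by (simp add: mult_smult_assoc_mat)
    finally show ?thesis using AU by simp
  qed
  define V where "V = Q * S * P"
  have V: "V \<in> carrier_mat p p" using Q S P by (simp add: V_def)
  have "M * V = 1\<^sub>m p"
  proof -
    have "Q * (P * M * Q) * S * P = (Q * P) * M * (Q * S * P)"
      using P Q M S by (simp add: assoc_mult_mat[of _ p p _ p _ p])
    then have "M * V = Q * (P * M * Q) * S * P"
      using QP M V by (simp add: V_def[symmetric])
    also have "\<dots> = Q * ((P * M * Q) * S) * P"
      using P Q M S by (simp add: assoc_mult_mat[of _ p p _ p _ p])
    also have "\<dots> = 1\<^sub>m p"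
      using inv QP Q unfolding AM by simp
    finally show ?thesis .
  qed
  moreover have "upper_triangular M" using ut U by (auto simp: M_def upper_triangular_def)
  moreover have Mdiag: "M $$ (i, i) = es ! i + c" if "i < p" for i
    using that U by (simp add: M_def Udiag)
  moreover have "M $$ (i, i) \<noteq> 0" if "i < p" for i
    using that nz es(2) by (simp add: Mdiag)
  ultimately have "V $$ (i, i) = 1 / (es ! i + c)" if "i < p" for i
    using upper_triangular_inverse_diag[OF M V] that by simp
  then have "(\<Sum>i<p. 1 / (es ! i + c)) = (\<Sum>i<p. V $$ (i, i))" by simp
  also have "\<dots> = (\<Sum>i<p. (P * (Q * S)) $$ (i, i))"
    unfolding V_def using Q S P by (intro trace_mult_commute) auto
  also have "P * (Q * S) = S"
    using P Q S PQ by (simp add: assoc_mult_mat[of P p p Q p S p, symmetric])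
  finally show ?thesis ..
qed

section \<open>Eigenvalues and resolvent of the Gram matrix\<close>

lemma gram_mat_carrier: "gram_mat p n B s \<in> carrier_mat p p"
  by (rule carrier_matI) (simp_all add: gram_mat_def Phi_mat_def mat_adjoint_def)

lemma gram_mat_entry:
  assumes "i < p" "j < p"
  shows "gram_mat p n B s $$ (i, j) = ip {..<n} (svec B s i) (svec B s j)"
  using assms
  by (simp add: gram_mat_def Phi_mat_def mat_adjoint_def times_mat_def scalar_prod_def
      atLeast0LessThan ip_def svec_def bvec_def mat_of_rows_def)

text \<open>For an eigenvector w, the form w^* G w equals both e |w|^2 and |z|^2, where z is the sum
  of the cnj(w_i) v_i; so e is a quotient of squared norms.\<close>

lemma gram_eigenvalue_nonneg:
  assumes "eigenvalue (gram_mat p n B s) e"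
  shows "Im e = 0" "0 \<le> Re e"
proof -
  let ?G = "gram_mat p n B s" and ?v = "svec B s"
  obtain w where w: "w \<in> carrier_vec p" "w \<noteq> 0\<^sub>v p" "?G *\<^sub>v w = e \<cdot>\<^sub>v w"
    using assms gram_mat_carrier[of p n B s] by (auto simp: eigenvalue_def eigenvector_def)
  have row: "(\<Sum>j<p. ip {..<n} (?v i) (?v j) * vec_index w j) = e * vec_index w i" if "i < p" for i
  proof -
    have "vec_index (?G *\<^sub>v w) i = (\<Sum>j<p. ?G $$ (i, j) * vec_index w j)"
      using that w(1) gram_mat_carrier[of p n B s] by (simp add: scalar_prod_def atLeast0LessThan)
    then show ?thesis using w that by (simp add: gram_mat_entry)
  qed
  define z where "z = (\<lambda>k. \<Sum>i<p. cnj (vec_index w i) * ?v i k)"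
  have "ip {..<n} z z = (\<Sum>i<p. cnj (vec_index w i) * (\<Sum>j<p. vec_index w j * ip {..<n} (?v i) (?v j)))"
    unfolding z_def by (simp only: ip_sum_left ip_sum_right ip_scale_left ip_scale_right complex_cnj_cnj sum_distrib_left)
  also have "\<dots> = (\<Sum>i<p. cnj (vec_index w i) * (e * vec_index w i))"
  proof (intro sum.cong refl arg_cong2[where f = times])
    fix i assume "i \<in> {..<p}"
    then show "(\<Sum>j<p. vec_index w j * ip {..<n} (?v i) (?v j)) = e * vec_index w i"
      using row[of i] by (simp only: mult.commute lessThan_iff)
  qed
  also have "\<dots> = e * ip {..<p} (vec_index w) (vec_index w)"
    unfolding ip_def sum_distrib_left by (simp only: mult_ac)
  finally have e: "e * of_real (nrm2 {..<p} (vec_index w)) = of_real (nrm2 {..<n} z)"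
    by (simp only: ip_self)
  have "nrm2 {..<p} (vec_index w) \<noteq> 0"
  proof
    assume "nrm2 {..<p} (vec_index w) = 0"
    then have "vec_index w i = 0" if "i < p" for i
      using nrm2_eq_0[of "{..<p}" "vec_index w" i] that by simp
    then have "w = 0\<^sub>v p" using w(1) by (intro eq_vecI) auto
    with w(2) show False by simp
  qed
  then have "e = of_real (nrm2 {..<n} z / nrm2 {..<p} (vec_index w))"
    using e by (simp add: field_simps)
  then show "Im e = 0" "0 \<le> Re e"
    by (simp_all only: Im_complex_of_real Re_complex_of_real divide_nonneg_nonneg nrm2_nonneg)
qed

text \<open>The push-through identity \<open>(\<Phi>\<Phi>\<^sup>* + t)\<^sup>-\<^sup>1 = (1 - \<Phi> R \<Phi>\<^sup>*) / t\<close>.\<close>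

lemma gram_resolvent_inverse:
  fixes p n :: nat and B :: "nat \<Rightarrow> nat \<Rightarrow> complex Matrix.vec" and s :: "nat \<Rightarrow> nat \<times> nat"
  assumes t: "0 < t"
  defines "S \<equiv> mat p p (\<lambda>(i, j). ((if i = j then 1 else 0)
     - ip {..<n} (svec B s i) (mat_app n (resolv n t (svec B s) {..<p}) (svec B s j))) / of_real t)"
  shows "(gram_mat p n B s + of_real t \<cdot>\<^sub>m 1\<^sub>m p) * S = 1\<^sub>m p"
proof (rule eq_matI)
  let ?v = "svec B s" and ?G = "gram_mat p n B s"
  let ?R = "mat_app n (resolv n t (svec B s) {..<p})"
  define X where "X = (\<lambda>i j. ip {..<n} (?v i) (?R (?v j)))"
  define G where "G = (\<lambda>i j. ip {..<n} (?v i) (?v j))"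
  \<comment> \<open>The resolvent equation for \<open>?R (?v j)\<close> paired with
    \<open>?v i\<close>. As matrices G X = G - t X, which makes (G + t) (1 - X) equal to t.\<close>
  have GX: "(\<Sum>l<p. G i l * X l j) = G i j - of_real t * X i j" for i j
  proof -
    have "G i j = ip {..<n} (?v i) (frame_op n t ?v {..<p} (?R (?v j)))"
      unfolding G_def by (rule ip_cong) (auto simp: frame_op_resolv[OF t])
    also have "\<dots> = of_real t * X i j + (\<Sum>l<p. G i l * X l j)"
      unfolding ip_frame_op_commute[symmetric] ip_frame_op X_def G_def ..
    finally show ?thesis by simp
  qed
  fix i j assume "i < dim_row (1\<^sub>m p :: complex mat)" "j < dim_col (1\<^sub>m p :: complex mat)"
  then have i: "i < p" and j: "j < p" by auto
  have "((?G + of_real t \<cdot>\<^sub>m 1\<^sub>m p) * S) $$ (i, j)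
    = (\<Sum>l<p. (G i l + (if l = i then of_real t else 0)) * (((if l = j then 1 else 0) - X l j) / of_real t))"
    using i j gram_mat_carrier[of p n B s]
    by (simp add: times_mat_def scalar_prod_def atLeast0LessThan S_def gram_mat_entry G_def X_def
        if_distrib[where f = "\<lambda>x. of_real t * x"] cong: if_cong)
  also have "\<dots> = (\<Sum>l<p. (G i l * (if l = j then 1 else 0) - G i l * X l j) / of_real t
        + (if l = i then (if l = j then 1 else 0) - X l j else 0))"
  proof (intro sum.cong refl)
    have *: "(g + (if b then \<tau> else 0)) * ((h - x) / \<tau>) = (g * h - g * x) / \<tau> + (if b then h - x else 0)"
      if "\<tau> \<noteq> 0" for g h x \<tau> :: complex and b
      using that by (cases b) (simp_all add: field_simps)
    show "(G i l + (if l = i then of_real t else 0)) * (((if l = j then 1 else 0) - X l j) / of_real t)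
      = (G i l * (if l = j then 1 else 0) - G i l * X l j) / of_real t
        + (if l = i then (if l = j then 1 else 0) - X l j else 0)" for l
      by (rule *) (use t in simp)
  qed
  also have "\<dots> = ((\<Sum>l<p. G i l * (if l = j then 1 else 0)) - (\<Sum>l<p. G i l * X l j)) / of_real t
        + ((if i = j then 1 else 0) - X i j)"
    unfolding sum.distrib sum_subtractf[symmetric] sum_divide_distrib using i by (simp add: sum.delta)
  also have "(\<Sum>l<p. G i l * (if l = j then 1 else 0)) = G i j"
    using j by (simp add: if_distrib[where f = "\<lambda>x. _ * x"] cong: if_cong)
  also have "(G i j - (\<Sum>l<p. G i l * X l j)) / of_real t + ((if i = j then 1 else 0) - X i j)
      = (if i = j then 1 else 0)"
    unfolding GX using t by simp
  finally show "((?G + of_real t \<cdot>\<^sub>m 1\<^sub>m p) * S) $$ (i, j) = 1\<^sub>m p $$ (i, j)"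
    using i j by simp
qed (use gram_mat_carrier[of p n B s] in \<open>simp_all add: S_def\<close>)

text \<open>The term (p - n)/t is the mismatch between a p x p and an n x n trace whose matrices
  share their nonzero spectrum; it comes out of \<open>rtrace_identity\<close> applied to the trace
  of the push-through inverse.\<close>

lemma gram_spectrum:
  "\<exists>lam. (\<forall>i<p. 0 \<le> lam i) \<and>
     (\<forall>x. esd (gram_mat p n B s) x = (\<Sum>i<p. indicator {..x} (lam i)) / real p) \<and>
     (\<forall>t>0. (\<Sum>i<p. 1 / (lam i + t)) = (real p - real n) / t + Re (rtrace n t (svec B s) {..<p}))"
proof -
  let ?G = "gram_mat p n B s"
  note G = gram_mat_carrier[of p n B s]
  obtain es where es: "char_poly ?G = (\<Prod>a\<leftarrow>es. [:- a, 1:])" "length es = p"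
    using char_poly_factorized[OF G] by auto
  have ev: "eigenvalue ?G e" if "e \<in> set es" for e
    unfolding eigenvalue_root_char_poly[OF G] es
    using that by (auto simp: poly_prod_list prod_list_zero_iff image_iff)
  have im: "Im e = 0" and re: "0 \<le> Re e" if "e \<in> set es" for e
    using gram_eigenvalue_nonneg[OF ev[OF that]] by auto
  have tr: "(\<Sum>i<p. 1 / (Re (es ! i) + t)) = (real p - real n) / t + Re (rtrace n t (svec B s) {..<p})"
    if t: "0 < t" for t
  proof -
    let ?R = "mat_app n (resolv n t (svec B s) {..<p})"
    define S where "S = mat p p (\<lambda>(i, j). ((if i = j then 1 else 0)
       - ip {..<n} (svec B s i) (?R (svec B s j))) / complex_of_real t)"
    have S: "S \<in> carrier_mat p p" by (simp add: S_def)
    have nz: "e + of_real t \<noteq> 0" if "e \<in> set es" for e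
      using re[OF that] t by (auto simp: complex_eq_iff)
    have "(\<Sum>i<p. 1 / (es ! i + of_real t)) = (\<Sum>i<p. S $$ (i, i))"
      by (rule trace_inverse_eq_sum_eigenvalues[OF G S es, symmetric], erule nz)
        (unfold S_def, rule gram_resolvent_inverse[OF t])
    also have "\<dots> = (\<Sum>i<p. of_real ((1 - rquad n t (svec B s) {..<p} (svec B s i)) / t))"
      by (intro sum.cong refl) (simp add: S_def ip_resolv_self(1)[OF t])
    also have "\<dots> = of_real ((\<Sum>i<p. 1 - rquad n t (svec B s) {..<p} (svec B s i)) / t)"
      unfolding of_real_sum sum_divide_distrib ..
    finally have "(\<Sum>i<p. 1 / (es ! i + of_real t))
        = of_real ((\<Sum>i<p. 1 - rquad n t (svec B s) {..<p} (svec B s i)) / t)" .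
    moreover have "1 / (es ! i + of_real t) = of_real (1 / (Re (es ! i) + t))" if "i < p" for i
    proof -
      have "es ! i = of_real (Re (es ! i))" using im[of "es ! i"] that es(2) by (simp add: complex_eq_iff)
      then show ?thesis by (metis of_real_add of_real_divide of_real_1)
    qed
    then have "(\<Sum>i<p. 1 / (es ! i + of_real t)) = complex_of_real (\<Sum>i<p. 1 / (Re (es ! i) + t))"
      unfolding of_real_sum by (intro sum.cong refl) simp
    ultimately have "complex_of_real (\<Sum>i<p. 1 / (Re (es ! i) + t))
        = of_real ((\<Sum>i<p. 1 - rquad n t (svec B s) {..<p} (svec B s i)) / t)"
      by (simp only:)
    then have "(\<Sum>i<p. 1 / (Re (es ! i) + t)) = (\<Sum>i<p. 1 - rquad n t (svec B s) {..<p} (svec B s i)) / t"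
      by (simp only: of_real_eq_iff)
    also have "(\<Sum>i<p. 1 - rquad n t (svec B s) {..<p} (svec B s i))
        = real p - (real n - t * Re (rtrace n t (svec B s) {..<p}))"
    proof -
      have "t * Re (rtrace n t (svec B s) {..<p}) + (\<Sum>i<p. rquad n t (svec B s) {..<p} (svec B s i)) = real n"
        using arg_cong[OF rtrace_identity[OF t, of n "svec B s" "{..<p}"], of Re] by simp
      then show ?thesis by (simp add: sum_subtractf)
    qed
    finally show ?thesis using t by (simp add: field_simps)
  qed
  show ?thesis
    by (rule exI[of _ "\<lambda>i. Re (es ! i)"])
      (use re es(2) tr esd_eq_eigenvalue_count[OF G es im] in auto)
qed

definition gram_ev :: "nat \<Rightarrow> nat \<Rightarrow> (nat \<Rightarrow> nat \<Rightarrow> complex Matrix.vec) \<Rightarrow> (nat \<Rightarrow> nat \<times> nat) \<Rightarrow> nat \<Rightarrow> real" where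
  "gram_ev p n B s = (SOME lam. (\<forall>i<p. 0 \<le> lam i) \<and>
     (\<forall>x. esd (gram_mat p n B s) x = (\<Sum>i<p. indicator {..x} (lam i)) / real p) \<and>
     (\<forall>t>0. (\<Sum>i<p. 1 / (lam i + t)) = (real p - real n) / t + Re (rtrace n t (svec B s) {..<p})))"

lemma gram_ev:
  shows "i < p \<Longrightarrow> 0 \<le> gram_ev p n B s i"
    and "esd (gram_mat p n B s) x = (\<Sum>i<p. indicator {..x} (gram_ev p n B s i)) / real p"
    and "0 < t \<Longrightarrow> (\<Sum>i<p. 1 / (gram_ev p n B s i + t)) = (real p - real n) / t + Re (rtrace n t (svec B s) {..<p})"
proof -
  note ev = someI_ex[OF gram_spectrum[of p n B s], folded gram_ev_def]
  show "i < p \<Longrightarrow> 0 \<le> gram_ev p n B s i" using ev by blast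
  show "esd (gram_mat p n B s) x = (\<Sum>i<p. indicator {..x} (gram_ev p n B s i)) / real p" using ev by blast
  show "0 < t \<Longrightarrow> (\<Sum>i<p. 1 / (gram_ev p n B s i + t)) = (real p - real n) / t + Re (rtrace n t (svec B s) {..<p})"
    using ev by blast
qed

section \<open>From Stieltjes transforms to distribution functions\<close>

lemma tendsto_0_squeeze:
  fixes f g :: "nat \<Rightarrow> real"
  assumes "\<And>k. 0 \<le> f k" "\<And>k. f k \<le> g k" "g \<longlonglongrightarrow> 0"
  shows "f \<longlonglongrightarrow> 0"
  by (rule tendsto_sandwich[OF _ _ tendsto_const assms(3)]) (simp_all add: assms(1,2))

text \<open>The sample spaces are finite with uniform weight, so an expectation is a plain average.
  The limit law \<open>M\<close> is any law on the nonnegative half-line, and \<open>lam k s\<close>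
  lists one random spectrum.\<close>

locale random_spectra = prob_space M for M :: "real measure" +
  fixes \<Omega> :: "nat \<Rightarrow> 's set" and p :: "nat \<Rightarrow> nat" and lam :: "nat \<Rightarrow> 's \<Rightarrow> nat \<Rightarrow> real"
  assumes sets_M [measurable_cong, simp]: "sets M = sets borel"
    and AE_nonneg: "AE x in M. 0 \<le> x"
    and finite_\<Omega>: "finite (\<Omega> k)" and nonempty_\<Omega>: "\<Omega> k \<noteq> {}"
    and p_pos: "0 < p k" and lam_nonneg: "i < p k \<Longrightarrow> 0 \<le> lam k s i"
begin

definition emp :: "nat \<Rightarrow> 's \<Rightarrow> (real \<Rightarrow> real) \<Rightarrow> real" where
  "emp k s f = (\<Sum>i<p k. f (lam k s i)) / real (p k)"

text \<open>An L^1 distance: it controls probabilities by Markov's inequality and obeys the triangle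
  inequality, so the test functions with vanishing deviation are closed under linear combinations
  and uniform limits.\<close>

definition dev :: "(real \<Rightarrow> real) \<Rightarrow> nat \<Rightarrow> real" where
  "dev f k = (\<Sum>s\<in>\<Omega> k. \<bar>emp k s f - integral\<^sup>L M f\<bar>) / real (card (\<Omega> k))"

definition conv :: "(real \<Rightarrow> real) \<Rightarrow> bool" where
  "conv f \<longleftrightarrow> integrable M f \<and> dev f \<longlonglongrightarrow> 0"

lemma card_\<Omega>_pos: "0 < real (card (\<Omega> k))"
  using finite_\<Omega> nonempty_\<Omega> by (simp add: card_gt_0_iff)

lemma dev_nonneg: "0 \<le> dev f k"
  unfolding dev_def by (intro divide_nonneg_nonneg sum_nonneg) auto

lemma dev_le:
  assumes "\<And>s. s \<in> \<Omega> k \<Longrightarrow> \<bar>emp k s f - integral\<^sup>L M f\<bar>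
     \<le> a * \<bar>emp k s g - integral\<^sup>L M g\<bar> + b * \<bar>emp k s h - integral\<^sup>L M h\<bar> + c"
  shows "dev f k \<le> a * dev g k + b * dev h k + c"
proof -
  let ?N = "real (card (\<Omega> k))"
  have "(\<Sum>s\<in>\<Omega> k. \<bar>emp k s f - integral\<^sup>L M f\<bar>)
     \<le> (\<Sum>s\<in>\<Omega> k. a * \<bar>emp k s g - integral\<^sup>L M g\<bar> + b * \<bar>emp k s h - integral\<^sup>L M h\<bar> + c)"
    by (rule sum_mono) (rule assms)
  also have "\<dots> = a * (\<Sum>s\<in>\<Omega> k. \<bar>emp k s g - integral\<^sup>L M g\<bar>)
      + b * (\<Sum>s\<in>\<Omega> k. \<bar>emp k s h - integral\<^sup>L M h\<bar>) + ?N * c"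
    by (simp add: sum.distrib sum_distrib_left)
  finally have "dev f k \<le> (a * (\<Sum>s\<in>\<Omega> k. \<bar>emp k s g - integral\<^sup>L M g\<bar>)
      + b * (\<Sum>s\<in>\<Omega> k. \<bar>emp k s h - integral\<^sup>L M h\<bar>) + ?N * c) / ?N"
    unfolding dev_def by (rule divide_right_mono) simp
  also have "\<dots> = a * dev g k + b * dev h k + c"
    unfolding dev_def add_divide_distrib using card_\<Omega>_pos[of k] by simp
  finally show ?thesis .
qed

lemma emp_linear: "emp k s (\<lambda>x. a * f x + b * g x) = a * emp k s f + b * emp k s g"
  by (simp add: emp_def sum.distrib sum_distrib_left add_divide_distrib)

lemma emp_const: "emp k s (\<lambda>x. c) = c"
  using p_pos[of k] by (simp add: emp_def)

lemma emp_mono: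
  assumes "\<And>u. 0 \<le> u \<Longrightarrow> f u \<le> g u"
  shows "emp k s f \<le> emp k s g"
  unfolding emp_def by (intro divide_right_mono sum_mono assms lam_nonneg) auto

lemma conv_linear:
  assumes "conv f" "conv g"
  shows "conv (\<lambda>x. a * f x + b * g x)"
proof -
  have i: "integrable M f" "integrable M g" using assms by (auto simp: conv_def)
  have "dev (\<lambda>x. a * f x + b * g x) k \<le> \<bar>a\<bar> * dev f k + \<bar>b\<bar> * dev g k + 0" for k
  proof (rule dev_le)
    fix s
    have "emp k s (\<lambda>x. a * f x + b * g x) - integral\<^sup>L M (\<lambda>x. a * f x + b * g x)
        = a * (emp k s f - integral\<^sup>L M f) + b * (emp k s g - integral\<^sup>L M g)"
      using i by (simp add: emp_linear algebra_simps)
    then show "\<bar>emp k s (\<lambda>x. a * f x + b * g x) - integral\<^sup>L M (\<lambda>x. a * f x + b * g x)\<bar>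
        \<le> \<bar>a\<bar> * \<bar>emp k s f - integral\<^sup>L M f\<bar> + \<bar>b\<bar> * \<bar>emp k s g - integral\<^sup>L M g\<bar> + 0"
      using abs_triangle_ineq[of "a * (emp k s f - integral\<^sup>L M f)" "b * (emp k s g - integral\<^sup>L M g)"]
      by (simp only: abs_mult add_0_right)
  qed
  moreover have "(\<lambda>k. \<bar>a\<bar> * dev f k + \<bar>b\<bar> * dev g k + 0) \<longlonglongrightarrow> \<bar>a\<bar> * 0 + \<bar>b\<bar> * 0 + 0"
    using assms unfolding conv_def by (intro tendsto_intros) auto
  then have "(\<lambda>k. \<bar>a\<bar> * dev f k + \<bar>b\<bar> * dev g k + 0) \<longlonglongrightarrow> 0" by simp
  ultimately have "dev (\<lambda>x. a * f x + b * g x) \<longlonglongrightarrow> 0"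
    by (rule tendsto_0_squeeze[OF dev_nonneg])
  then show ?thesis using i by (simp add: conv_def)
qed

lemma conv_const: "conv (\<lambda>_. c)"
  by (simp add: conv_def dev_def[abs_def] emp_const prob_space)

text \<open>Approximation is required on u >= 0 only, where the eigenvalues lie and \<open>M\<close>
  is concentrated. With error 0 the lemma also exchanges functions that agree there.\<close>

lemma conv_uniform_limit:
  assumes [measurable]: "f \<in> borel_measurable borel"
    and approx: "\<And>e. 0 < e \<Longrightarrow> \<exists>g. conv g \<and> (\<forall>u\<ge>0. \<bar>f u - g u\<bar> \<le> e)"
  shows "conv f"
proof -
  have f: "integrable M f"
  proof -
    obtain g where g: "conv g" "\<forall>u\<ge>0. \<bar>f u - g u\<bar> \<le> 1" using approx[of 1] by auto
    then have "integrable M (\<lambda>x. \<bar>g x\<bar> + 1)" by (auto simp: conv_def)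
    then show ?thesis
    proof (rule Bochner_Integration.integrable_bound)
      show "AE x in M. norm (f x) \<le> norm (\<bar>g x\<bar> + 1)"
        using AE_nonneg
      proof eventually_elim
        case (elim x)
        with g(2) have "\<bar>f x - g x\<bar> \<le> 1" by blast
        then show ?case unfolding real_norm_def by linarith
      qed
    qed measurable
  qed
  have "dev f \<longlonglongrightarrow> 0"
  proof (rule LIMSEQ_I)
    fix r :: real assume r: "0 < r"
    \<comment> \<open>One quarter is for the empirical mean, one for the integral, and the remaining
      half for \<open>dev g\<close>.\<close>
    then obtain g where g: "conv g" and fg: "\<And>u. 0 \<le> u \<Longrightarrow> \<bar>f u - g u\<bar> \<le> r / 4"
      using approx[of "r / 4"] by auto
    have gi: "integrable M g" using g by (simp add: conv_def)
    have d: "\<bar>integral\<^sup>L M f - integral\<^sup>L M g\<bar> \<le> r / 4"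
    proof -
      have "integral\<^sup>L M f - integral\<^sup>L M g = integral\<^sup>L M (\<lambda>x. f x - g x)" using f gi by simp
      also have "\<bar>\<dots>\<bar> \<le> integral\<^sup>L M (\<lambda>x. \<bar>f x - g x\<bar>)" by (rule integral_abs_bound)
      also have "\<dots> \<le> integral\<^sup>L M (\<lambda>x. r / 4)"
      proof (rule integral_mono_AE)
        show "AE x in M. \<bar>f x - g x\<bar> \<le> r / 4" using AE_nonneg by eventually_elim (rule fg)
      qed (use f gi in auto)
      finally show ?thesis by (simp add: prob_space)
    qed
    have le: "dev f k \<le> dev g k + r / 2" for k
    proof -
      have "\<bar>emp k s f - integral\<^sup>L M f\<bar> \<le> 1 * \<bar>emp k s g - integral\<^sup>L M g\<bar> + 0 * \<bar>emp k s g - integral\<^sup>L M g\<bar> + r / 2" for s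
      proof -
        have "f u \<le> 1 * g u + r / 4 * 1" "g u \<le> 1 * f u + r / 4 * 1" if "0 \<le> u" for u
          using fg[OF that] by linarith+
        then have "emp k s f \<le> emp k s (\<lambda>u. 1 * g u + r / 4 * 1)" "emp k s g \<le> emp k s (\<lambda>u. 1 * f u + r / 4 * 1)"
          by (auto intro!: emp_mono)
        then have "emp k s f \<le> emp k s g + r / 4" "emp k s g \<le> emp k s f + r / 4"
          unfolding emp_linear emp_const by simp_all
        then show ?thesis using d by (simp only: mult_1_left mult_zero_left)
      qed
      from dev_le[OF this] show ?thesis by simp
    qed
    obtain N where "\<And>k. k \<ge> N \<Longrightarrow> norm (dev g k - 0) < r / 2"
      using LIMSEQ_D[of "dev g" 0 "r / 2"] g r unfolding conv_def by auto
    then have "norm (dev f k - 0) < r" if "k \<ge> N" for k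
      using le[of k] dev_nonneg[of f k] dev_nonneg[of g k] that by fastforce
    then show "\<exists>N. \<forall>k\<ge>N. norm (dev f k - 0) < r" by blast
  qed
  with f show ?thesis by (simp add: conv_def)
qed

text \<open>For t different from 1, partial fractions split 1 / ((u + 1) (u + t)) and lower the
  exponent. The statement is general in t because the step at t calls the induction hypothesis both
  at 1 and at t.\<close>

lemma conv_power_resolvent:
  assumes base: "\<And>t. 0 < t \<Longrightarrow> conv (\<lambda>x. 1 / (x + t))" and "0 < t"
  shows "conv (\<lambda>x. (1 / (x + 1)) ^ j * (1 / (x + t)))"
  using \<open>0 < t\<close>
proof (induction j arbitrary: t)
  case 0
  then show ?case using base by simp
next
  case (Suc j)
  have ne: "conv (\<lambda>x. (1 / (x + 1)) ^ Suc j * (1 / (x + t)))" if t: "0 < t" "t \<noteq> 1" for t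
  proof (rule conv_uniform_limit)
    fix e :: real assume "0 < e"
    let ?g = "\<lambda>x. (1 / (t - 1)) * ((1 / (x + 1)) ^ j * (1 / (x + 1))) + (- 1 / (t - 1)) * ((1 / (x + 1)) ^ j * (1 / (x + t)))"
    have "conv ?g" by (intro conv_linear Suc.IH) (use t in auto)
    moreover have "(1 / (u + 1)) ^ Suc j * (1 / (u + t)) = ?g u" if "0 \<le> u" for u
    proof -
      have "1 / (u + 1) * (1 / (u + t)) = 1 / (t - 1) * (1 / (u + 1) - 1 / (u + t))"
        using that t by (simp add: divide_simps)
      then have "(1 / (u + 1)) ^ j * (1 / (u + 1) * (1 / (u + t)))
          = (1 / (u + 1)) ^ j * (1 / (t - 1) * (1 / (u + 1) - 1 / (u + t)))" by simp
      then show ?thesis by (simp add: algebra_simps)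
    qed
    ultimately show "\<exists>g. conv g \<and> (\<forall>u\<ge>0. \<bar>(1 / (u + 1)) ^ Suc j * (1 / (u + t)) - g u\<bar> \<le> e)"
      using \<open>0 < e\<close> by (intro exI[of _ ?g]) simp
  qed measurable
  show ?case
  proof (cases "t = 1")
    case False
    then show ?thesis using ne Suc.prems by simp
  next
    case True
    \<comment> \<open>The multiple pole is a uniform limit: one factor has its pole moved from -1 to
      -1 - e, which changes the value on u >= 0 by at most e.\<close>
    have "conv (\<lambda>x. (1 / (x + 1)) ^ Suc j * (1 / (x + 1)))"
    proof (rule conv_uniform_limit)
      fix e :: real assume e: "0 < e"
      have "\<bar>(1 / (u + 1)) ^ Suc j * (1 / (u + 1)) - (1 / (u + 1)) ^ Suc j * (1 / (u + (1 + e)))\<bar> \<le> e"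
        if u: "0 \<le> u" for u
      proof -
        have "1 / (u + 1) - 1 / (u + (1 + e)) = e / ((u + 1) * (u + (1 + e)))"
          using u e by (simp add: divide_simps)
        moreover have "e / ((u + 1) * (u + (1 + e))) \<le> e / 1"
        proof (rule divide_left_mono)
          show "1 \<le> (u + 1) * (u + (1 + e))"
            using mult_mono[of 1 "u + 1" 1 "u + (1 + e)"] u e by simp
        qed (use u e in auto)
        moreover have "0 \<le> e / ((u + 1) * (u + (1 + e)))" using u e by simp
        ultimately have 1: "\<bar>1 / (u + 1) - 1 / (u + (1 + e))\<bar> \<le> e" by linarith
        have 2: "\<bar>(1 / (u + 1)) ^ Suc j\<bar> \<le> 1" using u power_le_one[of "1 / (u + 1)" "Suc j"]
          by (simp del: power_Suc)
        have "\<bar>(1 / (u + 1)) ^ Suc j\<bar> * \<bar>1 / (u + 1) - 1 / (u + (1 + e))\<bar> \<le> 1 * e"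
          by (rule mult_mono[OF 2 1]) auto
        then show ?thesis unfolding abs_mult[symmetric] right_diff_distrib by simp
      qed
      then show "\<exists>g. conv g \<and> (\<forall>u\<ge>0. \<bar>(1 / (u + 1)) ^ Suc j * (1 / (u + 1)) - g u\<bar> \<le> e)"
        using ne[of "1 + e"] e by (intro exI[of _ "\<lambda>u. (1 / (u + 1)) ^ Suc j * (1 / (u + (1 + e)))"]) auto
    qed measurable
    then show ?thesis using True by simp
  qed
qed

text \<open>The substitution 1 / (u + 1) maps the half-line into [0,1], where polynomials
  approximate \<open>h\<close>; its positive powers are \<open>conv_power_resolvent\<close> at t =
  1.\<close>

lemma conv_continuous:
  assumes base: "\<And>t. 0 < t \<Longrightarrow> conv (\<lambda>x. 1 / (x + t))"
    and h: "continuous_on UNIV h"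
  shows "conv (\<lambda>x. h (1 / (x + 1)))"
proof (rule conv_uniform_limit)
  have [measurable]: "h \<in> borel_measurable borel"
    using h by (rule borel_measurable_continuous_onI)
  show "(\<lambda>x. h (1 / (x + 1))) \<in> borel_measurable borel" by measurable
  fix e :: real assume e: "0 < e"
  have "continuous_on {0..1} h" using h by (rule continuous_on_subset) simp
  from Stone_Weierstrass_real_polynomial_function[OF compact_Icc this e]
  obtain q where q: "real_polynomial_function q" "\<And>x. x \<in> {0..1} \<Longrightarrow> \<bar>h x - q x\<bar> < e" by auto
  obtain a N where aN: "q = (\<lambda>x. \<Sum>i\<le>N. a i * x ^ i)"
    using q(1) unfolding real_polynomial_function_iff_sum by blast
  have pw: "conv (\<lambda>x. (1 / (x + 1)) ^ i)" for i
  proof (cases i)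
    case 0
    then show ?thesis using conv_const[of 1] by simp
  next
    case (Suc j)
    then show ?thesis using conv_power_resolvent[OF base, of 1 j] by (simp add: mult.commute)
  qed
  have "conv (\<lambda>x. \<Sum>i\<le>N. a i * (1 / (x + 1)) ^ i)" for N
  proof (induction N)
    case 0
    then show ?case using conv_const[of "a 0"] by simp
  next
    case (Suc N)
    then show ?case using conv_linear[OF Suc pw[of "Suc N"], of 1 "a (Suc N)"] by simp
  qed
  then have "conv (\<lambda>x. q (1 / (x + 1)))" by (simp add: aN)
  moreover have "\<bar>h (1 / (u + 1)) - q (1 / (u + 1))\<bar> \<le> e" if "0 \<le> u" for u
    using q(2)[of "1 / (u + 1)"] that by simp
  ultimately show "\<exists>g. conv g \<and> (\<forall>u\<ge>0. \<bar>h (1 / (u + 1)) - g u\<bar> \<le> e)"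
    by blast
qed

section \<open>From continuous test functions to indicators\<close>

lemma ramp_tendsto:
  fixes c d :: real
  shows "c > 0 \<Longrightarrow> (\<lambda>j. max 0 (min 1 (c * real (Suc j) + d))) \<longlonglongrightarrow> 1"
    and "c < 0 \<Longrightarrow> (\<lambda>j. max 0 (min 1 (c * real (Suc j) + d))) \<longlonglongrightarrow> 0"
proof -
  assume c: "c > 0"
  have "filterlim (\<lambda>j. c * real (Suc j) + d) at_top sequentially" using c by real_asymp
  then have "eventually (\<lambda>j. 1 \<le> c * real (Suc j) + d) sequentially"
    by (simp add: filterlim_at_top)
  then have "eventually (\<lambda>j. max 0 (min 1 (c * real (Suc j) + d)) = 1) sequentially"
    by eventually_elim simp
  then show "(\<lambda>j. max 0 (min 1 (c * real (Suc j) + d))) \<longlonglongrightarrow> 1"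
    by (rule tendsto_eventually)
next
  assume c: "c < 0"
  have "filterlim (\<lambda>j. c * real (Suc j) + d) at_bot sequentially" using c by real_asymp
  then have "eventually (\<lambda>j. c * real (Suc j) + d \<le> 0) sequentially"
    by (simp add: filterlim_at_bot)
  then have "eventually (\<lambda>j. max 0 (min 1 (c * real (Suc j) + d)) = 0) sequentially"
    by eventually_elim simp
  then show "(\<lambda>j. max 0 (min 1 (c * real (Suc j) + d))) \<longlonglongrightarrow> 0"
    by (rule tendsto_eventually)
qed

text \<open>The integrals of \<open>l\<close> and \<open>h\<close> are within e/2 of that of
  \<open>f\<close>, so a deviation of \<open>f\<close> above e forces deviations of \<open>l\<close>
  and \<open>h\<close> totalling at least e/2; Markov's inequality yields the factor 2/e.\<close>

lemma sandwich_in_probability: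
  assumes approx: "\<And>e. 0 < e \<Longrightarrow> \<exists>l h. conv l \<and> conv h \<and> (\<forall>u\<ge>0. l u \<le> f u \<and> f u \<le> h u) \<and>
        integral\<^sup>L M f - e \<le> integral\<^sup>L M l \<and> integral\<^sup>L M h \<le> integral\<^sup>L M f + e"
    and e: "0 < e"
  shows "(\<lambda>k. real (card {s \<in> \<Omega> k. \<bar>emp k s f - integral\<^sup>L M f\<bar> > e}) / real (card (\<Omega> k))) \<longlonglongrightarrow> 0"
proof -
  obtain l h where l: "conv l" and h: "conv h" and lh: "\<And>u. 0 \<le> u \<Longrightarrow> l u \<le> f u" "\<And>u. 0 \<le> u \<Longrightarrow> f u \<le> h u"
    and I: "integral\<^sup>L M f - e / 2 \<le> integral\<^sup>L M l" "integral\<^sup>L M h \<le> integral\<^sup>L M f + e / 2"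
    using approx[of "e / 2"] e by auto
  have "real (card {s \<in> \<Omega> k. \<bar>emp k s f - integral\<^sup>L M f\<bar> > e}) / real (card (\<Omega> k)) \<le> 2 / e * (dev l k + dev h k)" for k
  proof -
    let ?A = "{s \<in> \<Omega> k. \<bar>emp k s f - integral\<^sup>L M f\<bar> > e}"
    let ?d = "\<lambda>s. \<bar>emp k s l - integral\<^sup>L M l\<bar> + \<bar>emp k s h - integral\<^sup>L M h\<bar>"
    have "e / 2 \<le> ?d s" if "s \<in> ?A" for s
    proof -
      have "emp k s l \<le> emp k s f" by (rule emp_mono) (rule lh(1))
      moreover have "emp k s f \<le> emp k s h" by (rule emp_mono) (rule lh(2))
      moreover have "e < \<bar>emp k s f - integral\<^sup>L M f\<bar>" using that by simp
      ultimately show ?thesis using I by linarith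
    qed
    then have "real (card ?A) * (e / 2) \<le> (\<Sum>s\<in>?A. ?d s)"
      by (rule sum_bounded_below)
    also have "\<dots> \<le> (\<Sum>s\<in>\<Omega> k. ?d s)"
      by (rule sum_mono2) (use finite_\<Omega> in auto)
    finally have "real (card ?A) * (e / 2) / real (card (\<Omega> k)) \<le> (\<Sum>s\<in>\<Omega> k. ?d s) / real (card (\<Omega> k))"
      by (rule divide_right_mono) simp
    also have "\<dots> = dev l k + dev h k" by (simp add: dev_def sum.distrib add_divide_distrib)
    finally show ?thesis using e by (simp add: field_simps)
  qed
  moreover have "(\<lambda>k. 2 / e * (dev l k + dev h k)) \<longlonglongrightarrow> 2 / e * (0 + 0)"
    using l h unfolding conv_def by (intro tendsto_intros) auto
  then have "(\<lambda>k. 2 / e * (dev l k + dev h k)) \<longlonglongrightarrow> 0" by simp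
  ultimately show ?thesis by (rule tendsto_0_squeeze[rotated]) simp
qed

text \<open>Ramps of growing slope in the variable 1 / (u + 1) enclose the indicator; lower and
  upper integrals have the same limit because \<open>M\<close> gives the point \<open>x\<close> no
  mass.\<close>

lemma cdf_in_probability:
  assumes base: "\<And>t. 0 < t \<Longrightarrow> conv (\<lambda>x. 1 / (x + t))"
    and atom: "AE u in M. u \<noteq> x" and x: "0 \<le> x" and e: "0 < e"
  shows "(\<lambda>k. real (card {s \<in> \<Omega> k. \<bar>emp k s (indicator {..x}) - integral\<^sup>L M (indicator {..x})\<bar> > e})
      / real (card (\<Omega> k))) \<longlonglongrightarrow> 0"
proof (rule sandwich_in_probability[OF _ e])
  let ?f = "indicator {..x} :: real \<Rightarrow> real"
  define w where "w = 1 / (x + 1)"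
  \<comment> \<open>1 / (u + 1) - w is positive before u = x and negative after it. With d = 0 the
    ramp is 0 at x and stays below the indicator; with d = 1 it is 1 at x and stays above.\<close>
  define R where "R = (\<lambda>d j u. max 0 (min 1 ((1 / (u + 1) - w) * real (Suc j) + d)))"
  have cR: "conv (R d j)" for d j
    unfolding R_def by (rule conv_continuous[OF base]) (auto intro!: continuous_intros)
  have sgn: "u < x \<Longrightarrow> 0 < 1 / (u + 1) - w" "x < u \<Longrightarrow> 1 / (u + 1) - w < 0" if "0 \<le> u" for u
    using x that by (auto simp: w_def divide_simps)
  have lim: "(\<lambda>j. integral\<^sup>L M (R d j)) \<longlonglongrightarrow> integral\<^sup>L M ?f" for d
  proof (rule integral_dominated_convergence[where w = "\<lambda>_. 1"])
    show "AE u in M. (\<lambda>j. R d j u) \<longlonglongrightarrow> ?f u"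
      using AE_nonneg atom
    proof eventually_elim
      case (elim u)
      then consider "u < x" | "x < u" by linarith
      then show ?case
        using ramp_tendsto[of "1 / (u + 1) - w" d] sgn[OF elim(1)] by cases (auto simp: R_def)
    qed
    show "R d j \<in> borel_measurable M" for j using cR[of d j] by (auto simp: conv_def)
  qed (auto simp: R_def)
  fix e' :: real assume e': "0 < e'"
  obtain j0 where j0: "\<bar>integral\<^sup>L M (R 0 j0) - integral\<^sup>L M ?f\<bar> < e'"
    using LIMSEQ_D[OF lim[of 0] e'] by auto
  obtain j1 where j1: "\<bar>integral\<^sup>L M (R 1 j1) - integral\<^sup>L M ?f\<bar> < e'"
    using LIMSEQ_D[OF lim[of 1] e'] by auto
  have "R 0 j u \<le> ?f u" "?f u \<le> R 1 j u" if u: "0 \<le> u" for u j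
  proof -
    show "R 0 j u \<le> ?f u"
    proof (cases "u \<le> x")
      case False
      then have "(1 / (u + 1) - w) * real (Suc j) \<le> 0"
        using sgn(2)[OF u] by (intro mult_nonpos_nonneg) auto
      then show ?thesis using False by (simp add: R_def)
    qed (simp add: R_def)
    show "?f u \<le> R 1 j u"
    proof (cases "u \<le> x")
      case True
      then have "0 \<le> 1 / (u + 1) - w" using u x by (simp add: w_def divide_simps)
      then have "0 \<le> (1 / (u + 1) - w) * real (Suc j)" by (intro mult_nonneg_nonneg) auto
      then show ?thesis using True by (simp add: R_def)
    qed (simp add: R_def)
  qed
  then show "\<exists>l h. conv l \<and> conv h \<and> (\<forall>u\<ge>0. l u \<le> ?f u \<and> ?f u \<le> h u) \<and>
      integral\<^sup>L M ?f - e' \<le> integral\<^sup>L M l \<and> integral\<^sup>L M h \<le> integral\<^sup>L M ?f + e'"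
    using cR j0 j1 by (intro exI[of _ "R 0 j0"] exI[of _ "R 1 j1"]) auto
qed

end

theorem theorem1:
  fixes y :: real
    and n p m :: "nat \<Rightarrow> nat"
    and B :: "nat \<Rightarrow> nat \<Rightarrow> nat \<Rightarrow> complex Matrix.vec"
    and x :: real
  assumes "0 < y" "y < 1"
    and "filterlim n at_top sequentially"
    and "\<And>k. n k \<ge> 2" "\<And>k. m k \<ge> 2" "\<And>k. real (m k) \<ge> sqrt (real (n k))"
    and "\<And>k. real (p k) = y * real (n k)"
    and "\<And>k. mutually_unbiased (n k) (m k) (B k)"
  shows "\<forall>\<epsilon>>0. (\<lambda>k. measure_pmf.prob (pmf_of_set (sample_space (p k) (m k) (n k)))
            {s. \<bar>esd (gram_mat (p k) (n k) (B k) s) x - mp_cdf y x\<bar> > \<epsilon>}) \<longlonglongrightarrow> 0"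
proof (intro allI impI)
  fix e :: real assume e: "0 < e"
  note y = assms(1,2)
  let ?\<Omega> = "\<lambda>k. sample_space (p k) (m k) (n k)"
  let ?lam = "\<lambda>k. gram_ev (p k) (n k) (B k)"
  have n0: "0 < n k" and m0: "0 < m k" for k using assms(4)[of k] assms(5)[of k] by auto
  have p0: "0 < p k" for k
  proof -
    have "0 < real (p k)" unfolding assms(7) using y n0[of k] by simp
    then show ?thesis by simp
  qed
  have card\<Omega>: "card (?\<Omega> k) \<noteq> 0" for k using n0[of k] m0[of k] by (simp add: card_sample_space)
  have fin\<Omega>: "finite (?\<Omega> k)" "?\<Omega> k \<noteq> {}" for k
    using card\<Omega>[of k] by (auto simp: card_eq_0_iff)
  interpret MP: prob_space "mp_measure y" by (rule mp_prob_space[OF y])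
  interpret random_spectra "mp_measure y" ?\<Omega> p ?lam
  proof unfold_locales
    show "sets (mp_measure y) = sets borel" by (simp add: sets_mp_measure[OF y])
    show "AE x in mp_measure y. 0 \<le> x" by (rule AE_mp_nonneg[OF y])
  qed (use fin\<Omega> p0 gram_ev(1) in auto)
  have base: "conv (\<lambda>x. 1 / (x + t))" if t: "0 < t" for t
  proof -
    define D where "D = sqrt ((1 - y + t)\<^sup>2 + 4 * y * t)"
    \<comment> \<open>The integral depends on \<open>mp_companion\<close> by the same affine
      relation as the eigenvalue average on the normalised trace, so their difference is the error
      in g divided by y.\<close>
    have int: "integral\<^sup>L (mp_measure y) (\<lambda>x. 1 / (x + t)) = (1 - 1 / y) / t + mp_companion y t / y"
      unfolding mp_stieltjes[OF y t] mp_companion_def D_def[symmetric]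
      using y t by (simp add: divide_simps)
    have "integrable (mp_measure y) (\<lambda>x. 1 / (x + t))"
    proof (rule MP.integrable_const_bound[where B = "1 / t"])
      show "AE x in mp_measure y. norm (1 / (x + t)) \<le> 1 / t"
        using AE_mp_nonneg[OF y] by eventually_elim (use t in \<open>auto intro!: divide_left_mono\<close>)
    qed simp
    moreover have "dev (\<lambda>x. 1 / (x + t)) k \<le> 1 / t\<^sup>2 * (1 / sqrt (real (m k)) + 1 / real (n k))" for k
    proof -
      have "\<bar>emp k s (\<lambda>x. 1 / (x + t)) - integral\<^sup>L (mp_measure y) (\<lambda>x. 1 / (x + t))\<bar>
          = \<bar>Re (rtrace (n k) t (svec (B k) s) {..<p k}) / real (n k) - mp_companion y t\<bar> / y" for s
      proof -
        let ?T = "Re (rtrace (n k) t (svec (B k) s) {..<p k})"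
        have "emp k s (\<lambda>x. 1 / (x + t)) = (1 - 1 / y) / t + ?T / real (n k) / y"
          unfolding emp_def gram_ev(3)[OF t] assms(7)
          using y t n0[of k] by (simp add: divide_simps) (simp add: algebra_simps)
        then have "emp k s (\<lambda>x. 1 / (x + t)) - integral\<^sup>L (mp_measure y) (\<lambda>x. 1 / (x + t))
            = (?T / real (n k) - mp_companion y t) / y"
          unfolding int by (simp add: diff_divide_distrib)
        then show ?thesis using y by (simp add: abs_divide)
      qed
      then have "dev (\<lambda>x. 1 / (x + t)) k
        = (\<Sum>s\<in>?\<Omega> k. \<bar>Re (rtrace (n k) t (svec (B k) s) {..<p k}) / real (n k) - mp_companion y t\<bar>) / y / real (card (?\<Omega> k))"
        unfolding dev_def by (simp only: sum_divide_distrib)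
      also have "\<dots> \<le> real (card (?\<Omega> k)) * (y / t\<^sup>2 * (1 / sqrt (real (m k)) + 1 / real (n k))) / y / real (card (?\<Omega> k))"
        using y by (intro divide_right_mono rtrace_L1[OF assms(8) n0 m0 t y(1) assms(7)]) auto
      also have "\<dots> = 1 / t\<^sup>2 * (1 / sqrt (real (m k)) + 1 / real (n k))"
        using y card\<Omega>[of k] by simp
      finally show ?thesis .
    qed
    \<comment> \<open>Since m >= sqrt n and n tends to infinity, so does m, and the Bessel error
      m^(-1/2) vanishes.\<close>
    moreover have "(\<lambda>k. 1 / t\<^sup>2 * (1 / sqrt (real (m k)) + 1 / real (n k))) \<longlonglongrightarrow> 1 / t\<^sup>2 * (0 + 0)"
    proof -
      have rn: "filterlim (\<lambda>k. real (n k)) at_top sequentially"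
        by (rule filterlim_compose[OF filterlim_real_sequentially assms(3)])
      have "filterlim (\<lambda>k. sqrt (real (n k))) at_top sequentially"
        by (rule filterlim_compose[OF sqrt_at_top rn])
      then have "filterlim (\<lambda>k. real (m k)) at_top sequentially"
        by (rule filterlim_at_top_mono) (use assms(6) in auto)
      then have "filterlim (\<lambda>k. sqrt (real (m k))) at_top sequentially"
        by (rule filterlim_compose[OF sqrt_at_top])
      then have "(\<lambda>k. 1 / sqrt (real (m k))) \<longlonglongrightarrow> 0" "(\<lambda>k. 1 / real (n k)) \<longlonglongrightarrow> 0"
        using rn by (auto intro!: tendsto_divide_0[OF tendsto_const] filterlim_at_top_imp_at_infinity)
      then show ?thesis by (intro tendsto_intros)
    qed
    then have "(\<lambda>k. 1 / t\<^sup>2 * (1 / sqrt (real (m k)) + 1 / real (n k))) \<longlonglongrightarrow> 0" by simp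
    ultimately show ?thesis
      unfolding conv_def by (intro conjI tendsto_0_squeeze[OF dev_nonneg])
  qed
  have esd: "esd (gram_mat (p k) (n k) (B k) s) x = emp k s (indicator {..x})" for k s
    by (simp only: emp_def gram_ev(2))
  have prob: "measure_pmf.prob (pmf_of_set (?\<Omega> k)) {s. \<bar>esd (gram_mat (p k) (n k) (B k) s) x - mp_cdf y x\<bar> > e}
      = real (card {s \<in> ?\<Omega> k. \<bar>emp k s (indicator {..x}) - integral\<^sup>L (mp_measure y) (indicator {..x})\<bar> > e}) / real (card (?\<Omega> k))" for k
    unfolding esd mp_cdf_eq[OF y]
    by (subst measure_pmf_of_set) (use fin\<Omega> in \<open>auto simp: Int_def\<close>)
  show "(\<lambda>k. measure_pmf.prob (pmf_of_set (?\<Omega> k))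
      {s. \<bar>esd (gram_mat (p k) (n k) (B k) s) x - mp_cdf y x\<bar> > e}) \<longlonglongrightarrow> 0"
  proof (cases "0 \<le> x")
    case True
    show ?thesis unfolding prob
      by (rule cdf_in_probability[OF base AE_mp_neq[OF y] True e])
  next
    \<comment> \<open>For x < 0 no eigenvalue and no mass of the limit law lies below x, so both
      distribution functions vanish.\<close>
    case False
    have "emp k s (indicator {..x}) = 0" for k s
      unfolding emp_def using gram_ev(1)[of _ "p k" "n k" "B k" s] False
      by (auto simp: indicator_def intro!: sum.neutral) (meson dual_order.trans)
    moreover have "integral\<^sup>L (mp_measure y) (indicator {..x}) = integral\<^sup>L (mp_measure y) (\<lambda>_. 0 :: real)"
    proof (rule integral_cong_AE)
      show "AE u in mp_measure y. indicator {..x} u = (0 :: real)"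
        using AE_mp_nonneg[OF y] by eventually_elim (use False in \<open>auto simp: indicator_def\<close>)
    qed simp_all
    ultimately show ?thesis unfolding prob using e by simp
  qed
qed

end
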